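(* Let $l_1,l_2\ge 1$ be integers, $l=l_1+l_2$, and $n\ge l$. Let $\Sigma\in\mathbb{R}^{l\times l}$ be symmetric positive definite and block diagonal, $\Sigma=\begin{bmatrix}\Sigma_{11}&O\\ O&\Sigma_{22}\end{bmatrix}$ with $\Sigma_{11}\in\mathbb{R}^{l_1\times l_1}$, $\Sigma_{22}\in\mathbb{R}^{l_2\times l_2}$. Let the random matrix $A=\begin{bmatrix}A_{11}&A_{12}\\ A_{12}^T&A_{22}\end{bmatrix}$, partitioned conformally with $\Sigma$, be distributed according to the Wishart distribution $\mathcal{W}_l(n,\Sigma)$. Then the conditional distribution of $A_{12}^T\in\mathbb{R}^{l_2\times l_1}$ given $A_{11},A_{22}$ is an inverted matrix variate $t$-distribution: $$A_{12}^T\mid A_{11},A_{22}\ \sim\ \mathcal{IT}_{l_2,l_1}(n-l+1,\,O,\,A_{22},\,A_{11}).$$ Equivalently, on the set of $A_{12}$ for which $A>0$, the conditional density is $$p(A_{12}\mid A_{11},A_{22})=Z\cdot\left(|A_{11}A_{22}|\,|I-A_{22}^{-1}A_{12}^TA_{11}^{-1}A_{12}|\right)^{\frac{n-l-1}{2}},$$ where $$Z=\frac{\Gamma_{l_2}\left(\frac n2\right)}{\Gamma_{l_2}\left(\frac12(n-l_1)\right)}\cdot\frac{1}{\pi^{\frac{l_1l_2}{2}}|A_{11}|^{\frac{n-l_1-1}{2}}|A_{22}|^{\frac{n-l_2-1}{2}}}.$$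
   Context: $|A|$ denotes the determinant, $A>B$ means that $A-B$ is positive definite, $O$ is a zero matrix, and $\Gamma_l(a)=\pi^{l(l-1)/4}\prod_{j=1}^l\Gamma\left(a-\frac12(j-1)\right)$ is the multivariate gamma function. Wishart distribution: for $n\ge l$ and positive definite $\Sigma\in\mathbb{R}^{l\times l}$, $\mathcal{W}_l(n,\Sigma)$ is the distribution on positive definite symmetric $l\times l$ matrices with density (with respect to Lebesgue measure on the entries on and above the diagonal) $$p(A)=\frac{|A|^{\frac{n-l-1}{2}}\exp\left(-\frac12\mathrm{tr}(\Sigma^{-1}A)\right)}{2^{\frac{ln}{2}}|\Sigma|^{\frac n2}\Gamma_l(\frac n2)}.$$ Inverted matrix variate $t$-distribution: for $\nu>0$, $M\in\mathbb{R}^{q\times m}$, and positive definite $\Sigma\in\mathbb{R}^{q\times q}$, $\Omega\in\mathbb{R}^{m\times m}$, $T\sim\mathcal{IT}_{q,m}(\nu,M,\Sigma,\Omega)$ means that $T\in\mathbb{R}^{q\times m}$ has density $$p(T)=\frac{\Gamma_q(\frac12(\nu+m+q-1))}{\pi^{\frac{mq}{2}}\Gamma_q(\frac12(\nu+q-1))}|\Sigma|^{-\frac m2}|\Omega|^{-\frac q2}\,|I-\Sigma^{-1}(T-M)\Omega^{-1}(T-M)^T|^{\frac{\nu-2}{2}}$$ on the set where $\Sigma-(T-M)\Omega^{-1}(T-M)^T>0$, and zero elsewhere. Conditional densities are defined as ratios of densities: $p(A_{12}\mid A_{11},A_{22})=p(A)/p(A_{11},A_{22})$, where $p(A_{11},A_{22})$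 is the joint marginal density of the diagonal blocks. *)

theory Defs
  imports "HOL-Probability.Probability"
begin

definition pos_def :: "real^'n^'n \<Rightarrow> bool" where
  "pos_def A \<longleftrightarrow> transpose A = A \<and> (\<forall>x. x \<noteq> 0 \<longrightarrow> x \<bullet> (A *v x) > 0)"

definition mv_gamma :: "nat \<Rightarrow> real \<Rightarrow> real" where
  "mv_gamma l a = pi powr (real l * (real l - 1) / 4) * (\<Prod>j = 1..l. Gamma (a - (real j - 1) / 2))"

(* Lebesgue measure on the entries on and above the diagonal of a symmetric matrix, transported
   to the matrices.  Such an entry is indexed by the unordered pair {i, j} (with i = j on the
   diagonal), so that no order on the index type is needed. *)
definition lborel_sym :: "(real^'n^'n) measure" where
  "lborel_sym = distr (\<Pi>\<^sub>M e \<in> {{i, j} | i j. True}. lborel) borel (\<lambda>f. \<chi> i j. f {i, j})"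

definition wishart_density :: "real \<Rightarrow> real^'l^'l \<Rightarrow> real^'l^'l \<Rightarrow> real" where
  "wishart_density n S A =
     (if pos_def A then
        det A powr ((n - real CARD('l) - 1) / 2) * exp (- (1/2) * trace (matrix_inv S ** A))
        / (2 powr (real CARD('l) * n / 2) * det S powr (n / 2) * mv_gamma CARD('l) (n / 2))
      else 0)"

(* T has CARD('q) rows and CARD('m) columns. *)
definition inv_matrix_t_density ::
  "real \<Rightarrow> real^'m^'q \<Rightarrow> real^'q^'q \<Rightarrow> real^'m^'m \<Rightarrow> real^'m^'q \<Rightarrow> real" where
  "inv_matrix_t_density \<nu> M S \<Omega> T =
     (if pos_def (S - (T - M) ** matrix_inv \<Omega> ** transpose (T - M)) then
        mv_gamma CARD('q) ((\<nu> + real CARD('m) + real CARD('q) - 1) / 2)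
        / (pi powr (real CARD('m) * real CARD('q) / 2)
           * mv_gamma CARD('q) ((\<nu> + real CARD('q) - 1) / 2))
        * det S powr (- real CARD('m) / 2) * det \<Omega> powr (- real CARD('q) / 2)
        * det (mat 1 - matrix_inv S ** (T - M) ** matrix_inv \<Omega> ** transpose (T - M))
            powr ((\<nu> - 2) / 2)
      else 0)"

definition inv_matrix_t ::
  "real \<Rightarrow> real^'m^'q \<Rightarrow> real^'q^'q \<Rightarrow> real^'m^'m \<Rightarrow> (real^'m^'q) measure" where
  "inv_matrix_t \<nu> M S \<Omega> = density lborel (\<lambda>T. ennreal (inv_matrix_t_density \<nu> M S \<Omega> T))"

definition block_matrix ::
  "real^'a^'a \<Rightarrow> real^'b^'a \<Rightarrow> real^'a^'b \<Rightarrow> real^'b^'b \<Rightarrow> real^('a::finite + 'b::finite)^('a + 'b)" where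
  "block_matrix A B C D =
     (\<chi> i j. case i of
        Inl i' \<Rightarrow> (case j of Inl j' \<Rightarrow> A $ i' $ j' | Inr j' \<Rightarrow> B $ i' $ j')
      | Inr i' \<Rightarrow> (case j of Inl j' \<Rightarrow> C $ i' $ j' | Inr j' \<Rightarrow> D $ i' $ j'))"

definition block11 :: "real^('a::finite + 'b::finite)^('a + 'b) \<Rightarrow> real^'a^'a" where
  "block11 A = (\<chi> i j. A $ Inl i $ Inl j)"

definition block12 :: "real^('a::finite + 'b::finite)^('a + 'b) \<Rightarrow> real^'b^'a" where
  "block12 A = (\<chi> i j. A $ Inl i $ Inr j)"

definition block22 :: "real^('a::finite + 'b::finite)^('a + 'b) \<Rightarrow> real^'b^'b" where
  "block22 A = (\<chi> i j. A $ Inr i $ Inr j)"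

definition diag_blocks_density ::
  "(real^('a::finite + 'b::finite)^('a + 'b) \<Rightarrow> real) \<Rightarrow> real^'a^'a \<Rightarrow> real^'b^'b \<Rightarrow> real" where
  "diag_blocks_density p A11 A22 =
     (\<integral>A12. p (block_matrix A11 A12 (transpose A12) A22) \<partial>lborel)"

definition conditional_density ::
  "(real^('a::finite + 'b::finite)^('a + 'b) \<Rightarrow> real) \<Rightarrow> real^'b^'a \<Rightarrow> real^'a^'a \<Rightarrow> real^'b^'b \<Rightarrow> real" where
  "conditional_density p A12 A11 A22 =
     p (block_matrix A11 A12 (transpose A12) A22) / diag_blocks_density p A11 A22"

(* The conditional distribution of X given Y = y is \<kappa> y.  It is determined only up to null sets
   of the law of Y, so \<kappa> is only required to agree almost everywhere with a Markov kernel
   disintegrating the joint law of (Y, X). *)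
definition has_conditional_distribution ::
  "'w measure \<Rightarrow> 'x measure \<Rightarrow> 'y measure \<Rightarrow> ('w \<Rightarrow> 'x) \<Rightarrow> ('w \<Rightarrow> 'y) \<Rightarrow> ('y \<Rightarrow> 'x measure) \<Rightarrow> bool" where
  "has_conditional_distribution M N K X Y \<kappa> \<longleftrightarrow>
     X \<in> measurable M N \<and> Y \<in> measurable M K \<and>
     (\<exists>\<kappa>' \<in> measurable K (prob_algebra N).
        (AE y in distr M K Y. \<kappa>' y = \<kappa> y) \<and>
        (\<forall>B \<in> sets K. \<forall>C \<in> sets N.
           emeasure M {\<omega> \<in> space M. Y \<omega> \<in> B \<and> X \<omega> \<in> C}
             = (\<integral>\<^sup>+ y \<in> B. emeasure (\<kappa>' y) C \<partial>distr M K Y)))"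

end

(* Since Sigma is block diagonal, the Wishart density depends on A12 only through |A|^a with
   a = (n-l-1)/2, and by the Schur complement |A| = |A11| |A22 - A12^T A11^-1 A12|.  So everything
   reduces to the constant  int |A22 - A12^T A11^-1 A12|_+^a dA12.  Writing A11 = C C^T and
   A12 = C X turns A12^T A11^-1 A12 into the sum of the rank-one matrices x x^T over the rows x
   of X.  For a single row, int |B - x x^T|_+^a dx is a multiple of |B|^(a+1/2) by the substitution
   x = R u with B = R R^T and the integral of (1 - |u|^2)^a over the unit ball, so Fubini removes
   the rows one at a time; the resulting product of Gamma quotients telescopes. *)

theory Submission
  imports Defs
begin

section \<open>Block matrices, determinants and Schur complements\<close>

text \<open>Three things shape the work around that computation. The index types carry no order, so
  there is no triangular form to work with: determinants of block matrices and the linear change of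
  variables are obtained by decomposition into elementary matrices, and the factorization A = C C^T
  only asks for some invertible C. The integrals are taken in [0, infinity] with the cone condition
  built into the integrand, so that no domain has to be tracked. Since n >= l gives a >= -1/2 > -1,
  the Beta integral converges at the first row, and every further row raises the exponent by 1/2,
  which is why the inductions vary the exponent. Finally, the claim concerns a distribution and not
  only a ratio of formulas: Lebesgue measure on symmetric matrices has to be identified with the
  product of the measures on the two diagonal blocks and on the off-diagonal block, and the joint
  density has to be turned into a Markov kernel, which must be a probability measure even where the
  marginal density vanishes.\<close>

lemma matrix_inv_inverse:
  fixes A :: "real^'n^'n"
  assumes "invertible A"
  shows "A ** matrix_inv A = mat 1" "matrix_inv A ** A = mat 1"
  using someI_ex[OF assms[unfolded invertible_def]] unfolding matrix_inv_def by auto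

lemma matrix_inv_eqI:
  fixes A B :: "real^'n^'n"
  assumes "A ** B = mat 1"
  shows "matrix_inv A = B"
proof -
  have "invertible A"
    using assms by (auto simp: invertible_right_inverse)
  then have "B = matrix_inv A ** (A ** B)"
    by (metis matrix_inv_inverse(2) matrix_mul_assoc matrix_mul_lid)
  then show ?thesis
    using assms by (simp add: matrix_mul_rid)
qed

lemma sum_UNIV_Plus:
  fixes f :: "'a::finite + 'b::finite \<Rightarrow> 'c::comm_monoid_add"
  shows "(\<Sum>x\<in>UNIV. f x) = (\<Sum>i\<in>UNIV. f (Inl i)) + (\<Sum>j\<in>UNIV. f (Inr j))"
  using sum.Plus[of UNIV UNIV f] by (simp add: o_def)

lemma block_matrix_nth [simp]:
  "block_matrix A B C D $ Inl i $ Inl i' = A $ i $ i'"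
  "block_matrix A B C D $ Inl i $ Inr j' = B $ i $ j'"
  "block_matrix A B C D $ Inr j $ Inl i' = C $ j $ i'"
  "block_matrix A B C D $ Inr j $ Inr j' = D $ j $ j'"
  by (simp_all add: block_matrix_def)

lemma vec_eq_iff_sum:
  fixes x y :: "'c^('a::finite + 'b::finite)"
  shows "x = y \<longleftrightarrow> (\<forall>i. x $ Inl i = y $ Inl i) \<and> (\<forall>j. x $ Inr j = y $ Inr j)"
  by (metis (no_types, lifting) vec_eq_iff sum.exhaust)

lemma block_matrix_mult:
  "block_matrix A B C D ** block_matrix A' B' C' D' =
     block_matrix (A ** A' + B ** C') (A ** B' + B ** D') (C ** A' + D ** C') (C ** B' + D ** D')"
  by (simp add: vec_eq_iff_sum matrix_matrix_mult_def sum_UNIV_Plus)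

lemma transpose_block_matrix:
  "transpose (block_matrix A B C D) = block_matrix (transpose A) (transpose C) (transpose B) (transpose D)"
  by (simp add: vec_eq_iff_sum transpose_def)

lemma mat_1_block: "block_matrix (mat 1) 0 0 (mat 1) = mat 1"
  by (simp add: vec_eq_iff_sum mat_def)

lemma block_matrix_eq_iff:
  "block_matrix A B C D = block_matrix A' B' C' D' \<longleftrightarrow> A = A' \<and> B = B' \<and> C = C' \<and> D = D'"
  by (auto simp: vec_eq_iff_sum vec_eq_iff)

text \<open>Extension of \<open>A\<close> by the identity outside the range of \<open>h\<close>.
  Taking \<open>Inl\<close> and \<open>Inr\<close> for \<open>h\<close> gives diag(A, I) and diag(I,
  D), so one determinant lemma serves both corners of a block matrix.\<close>

definition embed_matrix :: "('m \<Rightarrow> 'n) \<Rightarrow> real^'m^'m \<Rightarrow> real^'n^'n" where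
  "embed_matrix h A = (\<chi> i j. if i \<in> range h \<and> j \<in> range h then A $ inv h i $ inv h j else of_bool (i = j))"

lemma embed_matrix_mult:
  fixes h :: "'m::finite \<Rightarrow> 'n::finite"
  assumes "inj h"
  shows "embed_matrix h (A ** B) = embed_matrix h A ** embed_matrix h B"
proof -
  have "embed_matrix h (A ** B) $ i $ k = (embed_matrix h A ** embed_matrix h B) $ i $ k" for i k
  proof (cases "i \<in> range h")
    case True
    then obtain i' where i: "i = h i'" by auto
    have "(embed_matrix h A ** embed_matrix h B) $ i $ k
        = (\<Sum>j\<in>UNIV. embed_matrix h A $ i $ j * embed_matrix h B $ j $ k)"
      by (simp add: matrix_matrix_mult_def)
    also have "\<dots> = (\<Sum>j\<in>range h. embed_matrix h A $ i $ j * embed_matrix h B $ j $ k)"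
      by (rule sum.mono_neutral_right) (auto simp: embed_matrix_def i)
    also have "\<dots> = (\<Sum>j\<in>UNIV. A $ i' $ j * embed_matrix h B $ h j $ k)"
      using assms by (simp add: sum.reindex embed_matrix_def i)
    also have "\<dots> = embed_matrix h (A ** B) $ i $ k"
      using assms by (cases "k \<in> range h") (auto simp: embed_matrix_def i matrix_matrix_mult_def intro!: sum.neutral)
    finally show ?thesis ..
  next
    case False
    have "(embed_matrix h A ** embed_matrix h B) $ i $ k
        = (\<Sum>j\<in>UNIV. if i = j then embed_matrix h B $ j $ k else 0)"
      unfolding matrix_matrix_mult_def vec_lambda_beta
      by (intro sum.cong) (use False in \<open>auto simp: embed_matrix_def\<close>)
    also have "\<dots> = embed_matrix h (A ** B) $ i $ k"
      using False by (simp add: embed_matrix_def)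
    finally show ?thesis ..
  qed
  then show ?thesis by (simp add: vec_eq_iff)
qed

text \<open>A generator in \<open>induct_matrix_elementary\<close>. Its determinant is needed both
  for the embedding below and for the linear change of variables.\<close>

lemma det_elementary_add:
  fixes c :: real and m n :: "'n::finite"
  assumes "m \<noteq> n"
  shows "det (\<chi> i j. if i = m \<and> j = n then c else of_bool (i = j)) = 1"
proof -
  have "(\<chi> i j. if i = m \<and> j = n then c else of_bool (i = j))
      = (\<chi> k. if k = m then row m (mat 1) + c *s row n (mat 1) else row k (mat 1))"
    using assms by (auto simp: vec_eq_iff row_def mat_def)
  then show ?thesis
    using det_row_operation[OF assms, of "mat 1 :: real^'n^'n" c] by simp
qed

lemma det_elementary_swap:
  fixes u v :: "'k::finite"
  assumes "u \<noteq> v"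
  shows "det (\<chi> i j. (mat 1 :: real^'k^'k) $ i $ Transposition.transpose u v j) = -1"
  using assms by (subst det_permute_columns) (auto simp: permutes_swap_id sign_swap_id)

text \<open>Both sides are multiplicative in \<open>A\<close>, so it suffices to compare them on
  matrices with a zero row, diagonal matrices, swaps and row additions. The embedding sends each
  kind to a matrix of the same kind on the larger index type.\<close>

lemma det_embed_matrix:
  fixes h :: "'m::finite \<Rightarrow> 'n::finite"
  assumes h: "inj h"
  shows "det (embed_matrix h A) = det A"
proof (induction A rule: induct_matrix_elementary)
  case (1 A B)
  then show ?case by (simp add: embed_matrix_mult[OF h] det_mul)
next
  case (2 A i)
  then have "row (h i) (embed_matrix h A) = 0"
    using h by (auto simp: vec_eq_iff row_def embed_matrix_def)
  with 2 show ?case by (simp add: det_zero_row)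
next
  case (3 A)
  have "det (embed_matrix h A) = (\<Prod>i\<in>UNIV. embed_matrix h A $ i $ i)"
    by (rule det_diagonal) (use 3 h in \<open>auto simp: embed_matrix_def inj_eq\<close>)
  also have "\<dots> = (\<Prod>i\<in>range h. embed_matrix h A $ i $ i)"
    by (rule prod.mono_neutral_right) (auto simp: embed_matrix_def)
  also have "\<dots> = (\<Prod>i\<in>UNIV. A $ i $ i)"
    using h by (simp add: prod.reindex embed_matrix_def)
  also have "\<dots> = det A"
    by (rule det_diagonal[symmetric]) (use 3 in auto)
  finally show ?case .
next
  case (4 m n)
  have *: "embed_matrix h (\<chi> i j. mat 1 $ i $ Transposition.transpose m n j)
     = (\<chi> i j. mat 1 $ i $ Transposition.transpose (h m) (h n) j)"
    using h by (auto simp: vec_eq_iff embed_matrix_def mat_def Transposition.transpose_def inj_eq)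
  show ?case
    using 4 h unfolding * by (simp add: inj_eq det_elementary_swap)
next
  case (5 m n c)
  have "embed_matrix h (\<chi> i j. if i = m \<and> j = n then c else of_bool (i = j))
      = (\<chi> i j. if i = h m \<and> j = h n then c else of_bool (i = j))"
    using h by (auto simp: vec_eq_iff embed_matrix_def inj_eq)
  moreover have "h m \<noteq> h n" using 5 h by (simp add: inj_eq)
  ultimately show ?case
    using det_elementary_add[OF 5, of c] det_elementary_add[of "h m" "h n" c] by metis
qed

lemma det_block_diagonal:
  fixes A :: "real^'a::finite^'a" and D :: "real^'b::finite^'b"
  shows "det (block_matrix A 0 0 D) = det A * det D"
proof -
  have "embed_matrix Inl A = block_matrix A 0 0 (mat 1 :: real^'b^'b)"
    by (auto simp: vec_eq_iff_sum embed_matrix_def mat_def vec_eq_iff)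
  moreover have "embed_matrix Inr D = block_matrix (mat 1 :: real^'a^'a) 0 0 D"
    by (auto simp: vec_eq_iff_sum embed_matrix_def mat_def vec_eq_iff)
  moreover have "block_matrix A 0 0 D = block_matrix A 0 0 (mat 1) ** block_matrix (mat 1) 0 0 D"
    by (simp add: block_matrix_mult)
  ultimately show ?thesis
    by (metis det_mul det_embed_matrix inj_Inl inj_Inr)
qed

text \<open>Conjugation by \<open>diag(I, 2I)\<close> turns the unitriangular matrix with corner \<open>C\<close> into the one with
  corner \<open>2C\<close>, which is its square. Hence its determinant is a nonzero idempotent.\<close>

lemma det_block_lower_unitriangular:
  fixes C :: "real^'a::finite^'b::finite"
  shows "det (block_matrix (mat 1) 0 C (mat 1)) = 1"
proof -
  let ?L = "\<lambda>C :: real^'a^'b. block_matrix (mat 1) 0 C (mat 1)"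
  let ?E = "block_matrix (mat 1) 0 0 (mat 2) :: real^('a + 'b)^('a + 'b)"
  have add: "?L C ** ?L C' = ?L (C + C')" for C C'
    by (simp add: block_matrix_mult)
  have "?E ** ?L C = ?L (C + C) ** ?E"
    by (simp add: block_matrix_mult block_matrix_eq_iff)
      (simp add: vec_eq_iff matrix_matrix_mult_def mat_def if_distrib if_distribR cong: if_cong)
  moreover have "det ?E \<noteq> 0"
    by (simp add: det_block_diagonal det_diagonal mat_def)
  ultimately have "det (?L C) = det (?L (C + C))"
    by (metis det_mul mult.commute mult_left_cancel)
  then have "det (?L C) = det (?L C) * det (?L C)"
    by (metis add det_mul)
  moreover have "det (?L C) * det (?L (- C)) = 1"
    by (metis add det_mul right_minus mat_1_block det_I)
  ultimately show ?thesis
    by (metis mult_cancel_left2 mult_zero_left zero_neq_one)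
qed

section \<open>Positive definiteness, congruence and Schur complements\<close>

lemma pos_def_sym: "pos_def A \<Longrightarrow> transpose A = A"
  by (simp add: pos_def_def)

lemma pos_def_invertible:
  assumes "pos_def A"
  shows "invertible A"
proof -
  have "x = 0" if "A *v x = 0" for x
    using assms that by (force simp: pos_def_def)
  then show ?thesis
    by (simp add: invertible_left_inverse matrix_left_invertible_ker)
qed

text \<open>The form of C B C^T at x is the form of B at C^T x, and C^T x is nonzero when x is. The
  converse is the same argument for the inverse of \<open>C\<close>.\<close>

lemma pos_def_congruence:
  fixes B C :: "real^'n^'n"
  assumes "invertible C"
  shows "pos_def (C ** B ** transpose C) \<longleftrightarrow> pos_def B"
proof -
  have *: "pos_def (C ** B ** transpose C)" if "pos_def B" "invertible C" for B C :: "real^'n^'n"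
  proof -
    have "transpose (C ** B ** transpose C) = C ** B ** transpose C"
      using pos_def_sym[OF that(1)] by (simp add: matrix_transpose_mul matrix_mul_assoc)
    moreover have "x \<bullet> (C ** B ** transpose C *v x) > 0" if "x \<noteq> 0" for x
    proof -
      have "transpose C *v x \<noteq> 0"
        using that \<open>invertible C\<close> det_transpose[of C] invertible_eq_bij[of "transpose C"]
        by (metis bij_is_inj injD invertible_det_nz matrix_vector_mult_0_right)
      then have "(transpose C *v x) \<bullet> (B *v (transpose C *v x)) > 0"
        using \<open>pos_def B\<close> by (simp add: pos_def_def)
      then show ?thesis
        by (simp add: dot_lmul_matrix[symmetric] matrix_vector_mul_assoc[symmetric] transpose_matrix_vector)
    qed
    ultimately show ?thesis by (simp add: pos_def_def)
  qed
  obtain D where D: "D ** C = mat 1" "C ** D = mat 1"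
    using assms by (auto simp: invertible_def)
  have "D ** (C ** B ** transpose C) ** transpose D = (D ** C) ** B ** transpose (D ** C)"
    by (simp add: matrix_transpose_mul matrix_mul_assoc)
  then have "D ** (C ** B ** transpose C) ** transpose D = B"
    by (simp add: D)
  moreover have "invertible D" using D by (auto simp: invertible_def)
  ultimately show ?thesis
    using *[of "C ** B ** transpose C" D] *[of B C] assms by auto
qed

lemma transpose_zero [simp]: "transpose 0 = 0"
  by (simp add: transpose_def zero_vec_def)

text \<open>The quadratic form is tested on vectors supported in a single block.\<close>

lemma pos_def_block_imp_diagonal:
  fixes A :: "real^'a::finite^'a" and D :: "real^'b::finite^'b"
  assumes "pos_def (block_matrix A B C D)"
  shows "pos_def A" "pos_def D"
proof -
  have mv: "x \<bullet> (block_matrix A B C D *v x)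
      = (\<chi> i. x $ Inl i) \<bullet> (A *v (\<chi> i. x $ Inl i) + B *v (\<chi> i. x $ Inr i))
        + (\<chi> i. x $ Inr i) \<bullet> (C *v (\<chi> i. x $ Inl i) + D *v (\<chi> i. x $ Inr i))" for x
    by (simp add: inner_vec_def matrix_vector_mult_def sum_UNIV_Plus)
  have sym: "transpose A = A" "transpose D = D"
    using pos_def_sym[OF assms] by (auto simp: transpose_block_matrix block_matrix_eq_iff)
  have "y \<bullet> (A *v y) > 0" if "y \<noteq> 0" for y
  proof -
    let ?x = "(\<chi> k. case k of Inl i \<Rightarrow> y $ i | Inr j \<Rightarrow> 0) :: real^('a + 'b)"
    have "?x \<noteq> 0" using that by (auto simp: vec_eq_iff split: sum.splits)
    then have "?x \<bullet> (block_matrix A B C D *v ?x) > 0" using assms by (simp add: pos_def_def)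
    then show ?thesis by (simp add: mv flip: zero_vec_def)
  qed
  with sym show "pos_def A" by (simp add: pos_def_def)
  have "y \<bullet> (D *v y) > 0" if "y \<noteq> 0" for y
  proof -
    let ?x = "(\<chi> k. case k of Inl i \<Rightarrow> 0 | Inr j \<Rightarrow> y $ j) :: real^('a + 'b)"
    have "?x \<noteq> 0" using that by (auto simp: vec_eq_iff split: sum.splits)
    then have "?x \<bullet> (block_matrix A B C D *v ?x) > 0" using assms by (simp add: pos_def_def)
    then show ?thesis by (simp add: mv flip: zero_vec_def)
  qed
  with sym show "pos_def D" by (simp add: pos_def_def)
qed

lemma pos_def_block_diagonal:
  "pos_def (block_matrix A 0 0 D) \<longleftrightarrow> pos_def A \<and> pos_def D"
proof -
  have mv: "x \<bullet> (block_matrix A 0 0 D *v x)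
      = (\<chi> i. x $ Inl i) \<bullet> (A *v (\<chi> i. x $ Inl i)) + (\<chi> i. x $ Inr i) \<bullet> (D *v (\<chi> i. x $ Inr i))" for x
    by (simp add: inner_vec_def matrix_vector_mult_def sum_UNIV_Plus)
  have sym: "transpose (block_matrix A 0 0 D) = block_matrix A 0 0 D
      \<longleftrightarrow> transpose A = A \<and> transpose D = D"
    by (simp add: transpose_block_matrix block_matrix_eq_iff)
  show ?thesis
  proof
    assume L: "pos_def (block_matrix A 0 0 D)"
    then show "pos_def A \<and> pos_def D" by (blast dest: pos_def_block_imp_diagonal)
  next
    assume R: "pos_def A \<and> pos_def D"
    have "x \<bullet> (block_matrix A 0 0 D *v x) > 0" if "x \<noteq> 0" for x
    proof -
      have "(\<chi> i. x $ Inl i) \<noteq> 0 \<or> (\<chi> i. x $ Inr i) \<noteq> 0"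
        using that by (auto simp: vec_eq_iff_sum vec_eq_iff)
      moreover have "z \<bullet> (A *v z) \<ge> 0" "w \<bullet> (D *v w) \<ge> 0" for z w
        using R by (cases "z = 0"; cases "w = 0"; force simp: pos_def_def)+
      ultimately show ?thesis
        unfolding mv using R by (auto simp: pos_def_def intro: add_pos_nonneg add_nonneg_pos)
    qed
    then show "pos_def (block_matrix A 0 0 D)" using R sym by (auto simp: pos_def_def)
  qed
qed

lemma transpose_matrix_inv:
  fixes A :: "real^'n^'n"
  assumes "transpose A = A" "invertible A"
  shows "transpose (matrix_inv A) = matrix_inv A"
  by (metis assms matrix_inv_eqI matrix_inv_inverse(2) matrix_transpose_mul transpose_mat)

text \<open>Block elimination of \<open>B\<close> by a unitriangular congruence. Such a congruence
  changes neither the determinant nor positive definiteness, so this one identity yields both halves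
  of \<open>schur_complement_11\<close>.\<close>

lemma block_matrix_congruence_11:
  fixes A :: "real^'a::finite^'a" and B :: "real^'b::finite^'a"
  assumes "transpose A = A" "invertible A"
  defines "L \<equiv> block_matrix (mat 1) 0 (transpose B ** matrix_inv A) (mat 1)"
  shows "block_matrix A B (transpose B) D
    = L ** block_matrix A 0 0 (D - transpose B ** matrix_inv A ** B) ** transpose L"
  using matrix_inv_inverse[OF assms(2)]
  by (simp add: L_def block_matrix_mult transpose_block_matrix matrix_transpose_mul
      transpose_matrix_inv[OF assms(1,2)] matrix_mul_assoc[symmetric])
    (simp add: matrix_mul_assoc)

lemma block_matrix_congruence_22:
  fixes B :: "real^'b::finite^'a::finite" and D :: "real^'b^'b"
  assumes "transpose D = D" "invertible D"
  defines "U \<equiv> block_matrix (mat 1) (B ** matrix_inv D) 0 (mat 1)"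
  shows "block_matrix A B (transpose B) D
    = U ** block_matrix (A - B ** matrix_inv D ** transpose B) 0 0 D ** transpose U"
  using matrix_inv_inverse[OF assms(2)]
  by (simp add: U_def block_matrix_mult transpose_block_matrix matrix_transpose_mul
      transpose_matrix_inv[OF assms(1,2)] matrix_mul_assoc[symmetric])
    (simp add: matrix_mul_assoc)

lemma det_block_upper_unitriangular:
  fixes B :: "real^'b::finite^'a::finite"
  shows "det (block_matrix (mat 1) B 0 (mat 1)) = 1"
  using det_transpose[of "block_matrix (mat 1) B 0 (mat 1)"]
  by (simp add: transpose_block_matrix det_block_lower_unitriangular)

lemma schur_complement_11:
  fixes A :: "real^'a::finite^'a" and B :: "real^'b::finite^'a"
  assumes "pos_def A"
  shows "det (block_matrix A B (transpose B) D) = det A * det (D - transpose B ** matrix_inv A ** B)"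
    and "pos_def (block_matrix A B (transpose B) D) \<longleftrightarrow> pos_def (D - transpose B ** matrix_inv A ** B)"
  using assms
  by (simp_all add: block_matrix_congruence_11[OF pos_def_sym[OF assms] pos_def_invertible[OF assms]]
      det_mul det_block_lower_unitriangular det_block_diagonal pos_def_congruence
      invertible_det_nz pos_def_block_diagonal)

text \<open>Elimination from the other corner. Equating the two complements of the same bordered
  matrix is what evaluates the determinant of I - u u^T.\<close>

lemma schur_complement_22:
  fixes B :: "real^'b::finite^'a::finite" and D :: "real^'b^'b"
  assumes "pos_def D"
  shows "det (block_matrix A B (transpose B) D) = det (A - B ** matrix_inv D ** transpose B) * det D"
    and "pos_def (block_matrix A B (transpose B) D) \<longleftrightarrow> pos_def (A - B ** matrix_inv D ** transpose B)"
  using assms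
  by (simp_all add: block_matrix_congruence_22[OF pos_def_sym[OF assms] pos_def_invertible[OF assms]]
      det_mul det_block_upper_unitriangular det_block_diagonal pos_def_congruence
      invertible_det_nz pos_def_block_diagonal)

section \<open>Factorization and measurability of positive definite matrices\<close>

text \<open>Gram-Schmidt for the inner product x^T B y. While fewer vectors than the dimension have
  been found they span a proper subspace, so some \<open>v\<close> lies outside it, and its residual
  \<open>w\<close> is nonzero and can be normalized.\<close>

lemma pos_def_orthonormal_set:
  fixes B :: "real^'n^'n"
  assumes B: "pos_def B" and "k \<le> CARD('n)"
  shows "\<exists>S. finite S \<and> card S = k \<and> (\<forall>u\<in>S. \<forall>v\<in>S. u \<bullet> (B *v v) = of_bool (u = v))"
  using \<open>k \<le> CARD('n)\<close>
proof (induction k)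
  case 0
  then show ?case by (intro exI[of _ "{}"]) auto
next
  case (Suc k)
  then obtain S where S: "finite S" "card S = k"
    and orth: "\<And>u v. u \<in> S \<Longrightarrow> v \<in> S \<Longrightarrow> u \<bullet> (B *v v) = of_bool (u = v)"
    by auto
  have "dim S < DIM(real^'n)"
    using dim_le_card'[OF S(1)] S(2) Suc.prems by simp
  then have "span S \<noteq> UNIV"
    by (metis dim_UNIV dim_span less_irrefl)
  then obtain v where v: "v \<notin> span S" by auto
  define w where "w = v - (\<Sum>s\<in>S. (s \<bullet> (B *v v)) *\<^sub>R s)"
  have "(\<Sum>s\<in>S. (s \<bullet> (B *v v)) *\<^sub>R s) \<in> span S"
    by (intro span_sum span_scale span_base)
  with v have "w \<noteq> 0" by (auto simp: w_def)
  then have pos: "w \<bullet> (B *v w) > 0" using B by (simp add: pos_def_def)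
  have comm: "x \<bullet> (B *v y) = y \<bullet> (B *v x)" for x y
    using pos_def_sym[OF B] by (metis dot_lmul_matrix inner_commute transpose_matrix_vector)
  have sw: "s \<bullet> (B *v w) = 0" if "s \<in> S" for s
  proof -
    have "s \<bullet> (B *v w) = s \<bullet> (B *v v) - (\<Sum>t\<in>S. (t \<bullet> (B *v v)) * (s \<bullet> (B *v t)))"
      by (simp add: w_def matrix_vector_mult_diff_distrib inner_diff_right linear_sum[OF matrix_vector_mul_linear]
          inner_sum_right matrix_vector_mult_scaleR)
    also have "(\<Sum>t\<in>S. (t \<bullet> (B *v v)) * (s \<bullet> (B *v t))) = (\<Sum>t\<in>S. if s = t then t \<bullet> (B *v v) else 0)"
      by (intro sum.cong) (auto simp: orth that)
    finally show ?thesis using S(1) that by simp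
  qed
  define u where "u = (1 / sqrt (w \<bullet> (B *v w))) *\<^sub>R w"
  have uu: "u \<bullet> (B *v u) = 1"
    using pos by (simp add: u_def matrix_vector_mult_scaleR flip: power2_eq_square)
  have us: "s \<bullet> (B *v u) = 0" if "s \<in> S" for s
    using sw[OF that] by (simp add: u_def matrix_vector_mult_scaleR)
  have "u \<notin> S" using uu us by force
  show ?case
    by (rule exI[of _ "insert u S"]) (use S \<open>u \<notin> S\<close> uu us orth comm in auto)
qed

text \<open>Put a B-orthonormal basis into the columns of \<open>R\<close>, so that R^T B R = I;
  then C is the transposed inverse of R.\<close>

lemma pos_def_factorization:
  fixes B :: "real^'n^'n"
  assumes B: "pos_def B"
  obtains C :: "real^'n^'n" where "invertible C" "B = C ** transpose C"
proof -
  obtain S where S: "finite S" "card S = CARD('n)"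
    and orth: "\<And>u v. u \<in> S \<Longrightarrow> v \<in> S \<Longrightarrow> u \<bullet> (B *v v) = of_bool (u = v)"
    using pos_def_orthonormal_set[OF B order_refl] by auto
  obtain f where f: "bij_betw f (UNIV :: 'n set) S"
    using S finite_same_card_bij[of "UNIV :: 'n set" S] by auto
  define R :: "real^'n^'n" where "R = (\<chi> i j. f j $ i)"
  have "(transpose R ** (B ** R)) $ i $ j = f i \<bullet> (B *v f j)" for i j
    by (simp add: R_def matrix_matrix_mult_def transpose_def inner_vec_def matrix_vector_mult_def)
  also have "f i \<bullet> (B *v f j) = mat 1 $ i $ j" for i j
    using f orth[of "f i" "f j"] by (auto simp: mat_def bij_betw_def inj_eq)
  finally have one: "transpose R ** (B ** R) = mat 1"
    by (simp add: vec_eq_iff)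
  then have "det R * (det B * det R) = 1"
    by (metis det_I det_mul det_transpose)
  then have "invertible R" by (auto simp: invertible_det_nz)
  define D where "D = matrix_inv R"
  have RD: "R ** D = mat 1" "D ** R = mat 1"
    unfolding D_def by (rule matrix_inv_inverse[OF \<open>invertible R\<close>])+
  have "B = transpose (R ** D) ** B ** (R ** D)"
    by (simp add: RD)
  also have "\<dots> = transpose D ** (transpose R ** (B ** R)) ** D"
    by (simp add: matrix_transpose_mul matrix_mul_assoc)
  finally have "B = transpose D ** transpose (transpose D)"
    by (simp add: one)
  moreover have "invertible (transpose D)"
    using RD by (metis invertible_def matrix_transpose_mul transpose_mat)
  ultimately show ?thesis using that[of "transpose D"] by simp
qed

lemma pos_def_det_pos: "pos_def A \<Longrightarrow> det A > 0"
  by (metis det_mul det_transpose invertible_det_nz pos_def_factorization not_real_square_gt_zero)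

section \<open>Determinant powers of rank-one downdates\<close>

definition outer :: "real^'n \<Rightarrow> real^'n^'n" where
  "outer x = (\<chi> i j. x $ i * x $ j)"

lemma pos_def_mat_1: "pos_def (mat 1)"
  by (simp add: pos_def_def transpose_mat)

lemma pos_def_1: "pos_def (A :: real^1^1) \<longleftrightarrow> A $ 1 $ 1 > 0"
proof -
  have "transpose A = A" by (simp add: vec_eq_iff transpose_def)
  moreover have "x \<bullet> (A *v x) = A $ 1 $ 1 * (x $ 1)\<^sup>2" for x
    by (simp add: inner_vec_def matrix_vector_mult_def UNIV_1 power2_eq_square)
  moreover have "x \<noteq> 0 \<longleftrightarrow> x $ 1 \<noteq> 0" for x :: "real^1"
    by (simp add: vec_eq_iff)
  ultimately show ?thesis
    unfolding pos_def_def by (auto simp: zero_less_mult_iff dest: spec[of _ "vec 1"])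
qed

lemma matrix_inv_mat_1 [simp]: "matrix_inv (mat 1 :: real^'n^'n) = mat 1"
  by (rule matrix_inv_eqI) simp

text \<open>Both Schur complements of the bordered matrix \<open>[I, u; u\<^sup>T, 1]\<close>.\<close>

lemma mat_1_minus_outer:
  fixes u :: "real^'n"
  shows "det (mat 1 - outer u) = 1 - u \<bullet> u" "pos_def (mat 1 - outer u) \<longleftrightarrow> u \<bullet> u < 1"
proof -
  define X :: "real^1^'n" where "X = (\<chi> i j. u $ i)"
  have XX: "X ** transpose X = outer u"
    by (simp add: X_def outer_def vec_eq_iff matrix_matrix_mult_def transpose_def)
  have uu: "(mat 1 - transpose X ** X) $ 1 $ 1 = 1 - u \<bullet> u"
    by (simp add: X_def mat_def matrix_matrix_mult_def transpose_def inner_vec_def)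
  have one: "(mat 1 :: real^1^1) $ 1 $ 1 = 1"
    by (simp add: mat_def)
  note s1 = schur_complement_11[OF pos_def_mat_1, of X "mat 1 :: real^1^1"]
  note s2 = schur_complement_22[OF pos_def_mat_1, of "mat 1" X]
  show "det (mat 1 - outer u) = 1 - u \<bullet> u"
    using s1(1) s2(1) by (simp add: XX det_1 uu[simplified one vector_minus_component] one)
  show "pos_def (mat 1 - outer u) \<longleftrightarrow> u \<bullet> u < 1"
    using s1(2) s2(2) by (simp add: XX pos_def_1 uu[simplified one vector_minus_component] one)
qed

text \<open>The cone of positive definite matrices is part of the function, so integrals over the
  cone become integrals over the whole space. The condition det B > 0 could not replace it: an even
  number of negative eigenvalues also gives a positive determinant.\<close>

definition det_powr :: "real \<Rightarrow> real^'n^'n \<Rightarrow> real" where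
  "det_powr a B = (if pos_def B then det B powr a else 0)"

text \<open>If \<open>B\<close> is positive definite, both determinants on the right are positive
  and the power splits; otherwise \<open>pos_def_congruence\<close> makes both sides vanish.\<close>

lemma det_powr_congruence:
  fixes B C :: "real^'n^'n"
  assumes "invertible C"
  shows "det_powr a (C ** B ** transpose C) = det_powr a (C ** transpose C) * det_powr a B"
proof -
  have "pos_def (C ** transpose C)"
    using pos_def_congruence[OF assms, of "mat 1"] by (simp add: pos_def_mat_1)
  moreover have "det C * det C > 0"
    using assms by (simp add: invertible_det_nz zero_less_mult_iff linorder_neq_iff disj_commute)
  ultimately show ?thesis
    using pos_def_congruence[OF assms, of B] pos_def_det_pos[of B]
    by (simp add: det_powr_def det_mul powr_mult mult_ac)
qed

lemma outer_matrix_vector: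
  fixes C :: "real^'n^'m"
  shows "outer (C *v u) = C ** outer u ** transpose C"
  by (simp add: outer_def vec_eq_iff matrix_matrix_mult_def matrix_vector_mult_def transpose_def
      sum_distrib_left sum_distrib_right) (auto intro!: sum.cong simp: mult_ac)

lemma matrix_mult_diff_distrib:
  fixes A :: "real^'n^'m" and D :: "real^'k^'p"
  shows "A ** (B - C) = A ** B - A ** C" "(E - F) ** D = E ** D - F ** D"
  by (simp_all add: vec_eq_iff matrix_matrix_mult_def algebra_simps sum_subtractf)

lemma det_powr_minus_outer:
  fixes C :: "real^'n^'n"
  assumes "invertible C"
  shows "det_powr a (C ** transpose C - outer (C *v u))
    = det_powr a (C ** transpose C) * (if u \<bullet> u < 1 then (1 - u \<bullet> u) powr a else 0)"
proof -
  have "C ** transpose C - outer (C *v u) = C ** (mat 1 - outer u) ** transpose C"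
    by (simp add: outer_matrix_vector matrix_mult_diff_distrib)
  then show ?thesis
    by (simp add: det_powr_congruence[OF assms] det_powr_def[of a "mat 1 - outer u"] mat_1_minus_outer)
qed

text \<open>Adding back the positive semidefinite x x^T preserves positivity. Consequently the
  downdate integrand is identically zero when \<open>B\<close> is not positive definite, and the row
  formula holds for every matrix \<open>B\<close>.\<close>

lemma pos_def_minus_outerD:
  assumes "pos_def (B - outer x)"
  shows "pos_def B"
proof -
  have "transpose (outer x) = outer x"
    by (simp add: outer_def transpose_def mult.commute)
  then have "transpose B = B"
    using pos_def_sym[OF assms] by (simp add: transpose_def outer_def vec_eq_iff)
  moreover have "y \<bullet> (B *v y) > 0" if "y \<noteq> 0" for y
  proof -
    have "y \<bullet> ((B - outer x) *v y) > 0" using assms that by (simp add: pos_def_def)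
    moreover have "y \<bullet> (outer x *v y) = (x \<bullet> y)\<^sup>2"
      by (simp add: inner_vec_def outer_def matrix_vector_mult_def power2_eq_square sum_product
          sum_distrib_left mult_ac)
    ultimately show ?thesis
      using zero_le_power2[of "x \<bullet> y"]
      by (simp only: matrix_vector_mult_diff_rdistrib inner_diff_right)
  qed
  ultimately show ?thesis by (simp add: pos_def_def)
qed

section \<open>Measurability of determinants and of positive definiteness\<close>

lemma borel_measurable_vec_nth [measurable]:
  fixes f :: "'x \<Rightarrow> 'e::euclidean_space^'n"
  assumes [measurable]: "f \<in> borel_measurable M"
  shows "(\<lambda>x. f x $ i) \<in> borel_measurable M"
  by (rule measurable_compose[OF assms]) (intro borel_measurable_continuous_onI continuous_intros)

lemma borel_measurable_vec_lambda [measurable (raw)]: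
  fixes f :: "'x \<Rightarrow> 'n::finite \<Rightarrow> 'e::euclidean_space"
  assumes "\<And>i. (\<lambda>x. f x i) \<in> borel_measurable M"
  shows "(\<lambda>x. \<chi> i. f x i) \<in> borel_measurable M"
proof -
  have "(\<lambda>x. (\<chi> i. f x i) \<bullet> axis i u) \<in> borel_measurable M" for i u
    using assms[of i] by (simp add: inner_axis)
  then show ?thesis
    by (subst borel_measurable_euclidean_space) (auto simp: Basis_vec_def)
qed

lemma borel_measurable_det [measurable]: "det \<in> borel_measurable (borel :: (real^'n^'n) measure)"
  unfolding det_def by (intro borel_measurable_continuous_onI continuous_intros)

text \<open>Being nonpositive on some unit vector is a closed condition, because the sphere is compact.\<close>

lemma pred_pos_def [measurable]: "Measurable.pred (borel :: (real^'n^'n) measure) pos_def"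
proof -
  let ?S = "{A :: real^'n^'n. transpose A = A}"
  let ?N = "{A :: real^'n^'n. \<exists>x. x \<in> sphere 0 1 \<and> (x, A) \<in> {(x, A). x \<bullet> (A *v x) \<le> 0}}"
  have "closed ?S"
    unfolding transpose_def vec_eq_iff
    by (simp add: Collect_all_eq) (intro closed_INT ballI closed_Collect_eq continuous_intros)
  moreover have "closed {(x :: real^'n, A :: real^'n^'n). x \<bullet> (A *v x) \<le> 0}"
    unfolding inner_vec_def matrix_vector_mult_def case_prod_unfold
    by (intro closed_Collect_le continuous_intros)
  then have "closed ?N"
    by (intro closed_compact_projection) auto
  moreover have "{A. pos_def A} = ?S - ?N"
  proof -
    have "(\<forall>x. x \<noteq> 0 \<longrightarrow> x \<bullet> (A *v x) > 0) \<longleftrightarrow> (\<forall>x\<in>sphere 0 1. x \<bullet> (A *v x) > 0)" for A :: "real^'n^'n"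
    proof (intro iffI allI impI ballI)
      fix x :: "real^'n" assume pos: "\<forall>x\<in>sphere 0 1. x \<bullet> (A *v x) > 0" and "x \<noteq> 0"
      then have "(sgn x) \<bullet> (A *v sgn x) > 0" by (simp add: norm_sgn)
      then show "x \<bullet> (A *v x) > 0"
        using \<open>x \<noteq> 0\<close> by (simp add: sgn_div_norm matrix_vector_mult_scaleR zero_less_mult_iff)
    next
      fix x :: "real^'n" assume pos: "\<forall>x. x \<noteq> 0 \<longrightarrow> x \<bullet> (A *v x) > 0" and "x \<in> sphere 0 1"
      then have "x \<noteq> 0" by auto
      with pos show "x \<bullet> (A *v x) > 0" by blast
    qed
    then show ?thesis unfolding pos_def_def by (auto simp only: not_le; force simp: not_le)
  qed
  ultimately show ?thesis
    by (simp add: pred_def)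
qed

lemma borel_measurable_det_powr [measurable]:
  "det_powr a \<in> borel_measurable (borel :: (real^'n^'n) measure)"
  unfolding det_powr_def[abs_def] by measurable

section \<open>Linear change of variables for Lebesgue measure\<close>

text \<open>Checked on boxes. The free choice of the labelling \<open>e\<close> lets the same
  statement serve vectors, matrices indexed by pairs, and linear maps that permute the
  basis.\<close>

lemma lborel_eq_distr_PiM_Basis:
  fixes e :: "'i \<Rightarrow> 'e::euclidean_space"
  assumes e: "bij_betw e I Basis"
  shows "lborel = distr (Pi\<^sub>M I (\<lambda>_. lborel :: real measure)) borel (\<lambda>f. \<Sum>i\<in>I. f i *\<^sub>R e i)"
proof (rule lborel_eqI)
  interpret product_sigma_finite "\<lambda>_::'i. lborel :: real measure" ..
  have fin[simp]: "finite I" using bij_betw_finite[OF e] by simp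
  have dot: "(\<Sum>i\<in>I. f i *\<^sub>R e i) \<bullet> e j = f j" if "j \<in> I" for f j
  proof -
    have "e i \<bullet> e j = of_bool (i = j)" if "i \<in> I" for i
      using bij_betwE[OF e] bij_betw_imp_inj_on[OF e] that \<open>j \<in> I\<close>
      by (auto simp: inner_Basis inj_on_eq_iff)
    then have "(\<Sum>i\<in>I. f i *\<^sub>R e i) \<bullet> e j = (\<Sum>i\<in>I. if i = j then f i else 0)"
      unfolding inner_sum_left by (intro sum.cong) auto
    then show ?thesis using that by simp
  qed
  fix l u :: 'e assume le: "\<And>b. b \<in> Basis \<Longrightarrow> l \<bullet> b \<le> u \<bullet> b"
  have "(\<lambda>f. \<Sum>i\<in>I. f i *\<^sub>R e i) -` box l u \<inter> space (Pi\<^sub>M I (\<lambda>_. lborel :: real measure))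
      = Pi\<^sub>E I (\<lambda>i. {l \<bullet> e i <..< u \<bullet> e i})"
  proof -
    have "(\<Sum>i\<in>I. f i *\<^sub>R e i) \<in> box l u \<longleftrightarrow> (\<forall>i\<in>I. f i \<in> {l \<bullet> e i <..< u \<bullet> e i})" for f
      by (simp add: box_def bij_betw_imp_surj_on[OF e, symmetric] dot)
    then show ?thesis by (auto simp: space_PiM PiE_iff)
  qed
  then have "emeasure (distr (Pi\<^sub>M I (\<lambda>_. lborel :: real measure)) borel (\<lambda>f. \<Sum>i\<in>I. f i *\<^sub>R e i)) (box l u)
      = (\<Prod>i\<in>I. emeasure lborel {l \<bullet> e i <..< u \<bullet> e i})"
    by (subst emeasure_distr) (auto simp: emeasure_PiM)
  also have "\<dots> = (\<Prod>i\<in>I. ennreal ((u - l) \<bullet> e i))"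
    using e le by (intro prod.cong) (auto simp: inner_diff_left dest: bij_betwE)
  also have "\<dots> = ennreal (\<Prod>b\<in>Basis. (u - l) \<bullet> b)"
    using e le by (subst prod.reindex_bij_betw[OF e, symmetric], subst prod_ennreal)
      (auto simp: inner_diff_left bij_betw_def)
  finally show "emeasure (distr (Pi\<^sub>M I (\<lambda>_. lborel :: real measure)) borel (\<lambda>f. \<Sum>i\<in>I. f i *\<^sub>R e i)) (box l u)
      = (\<Prod>b\<in>Basis. (u - l) \<bullet> b)" .
qed simp

text \<open>Labelling the basis of the target by \<open>T\<close> gives the same product measure.
  The two spaces may differ, so this covers transposition of rectangular matrices as well as
  coordinate swaps.\<close>

lemma lborel_distr_bij_Basis:
  fixes T :: "'c::euclidean_space \<Rightarrow> 'd::euclidean_space"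
  assumes "linear T" and T: "bij_betw T Basis Basis"
  shows "distr lborel borel T = lborel"
proof -
  have [measurable]: "T \<in> borel_measurable borel"
    using \<open>linear T\<close> by (intro borel_measurable_continuous_onI linear_continuous_on linear_conv_bounded_linear[THEN iffD1])
  have "distr lborel borel T = distr (distr (Pi\<^sub>M Basis (\<lambda>_. lborel)) borel (\<lambda>f. \<Sum>i\<in>Basis. f i *\<^sub>R (id i :: 'c))) borel T"
    by (subst lborel_eq_distr_PiM_Basis[of id Basis]) auto
  also have "\<dots> = distr (Pi\<^sub>M Basis (\<lambda>_. lborel)) borel (\<lambda>f. \<Sum>i\<in>Basis. f i *\<^sub>R T i)"
    by (subst distr_distr) (auto simp: o_def linear_sum[OF \<open>linear T\<close>] linear_scale[OF \<open>linear T\<close>])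
  also have "\<dots> = lborel"
    by (rule lborel_eq_distr_PiM_Basis[OF T, symmetric])
  finally show ?thesis .
qed

lemma bij_betw_axis_Basis: "bij_betw (\<lambda>i. axis i (1::real)) UNIV (Basis :: (real^'n) set)"
  by (auto simp: bij_betw_def Basis_vec_def inj_on_def axis_eq_axis)

lemma nn_integral_lborel_vec:
  fixes f :: "real^'n \<Rightarrow> ennreal"
  assumes [measurable]: "f \<in> borel_measurable borel"
  shows "(\<integral>\<^sup>+x. f x \<partial>lborel) = (\<integral>\<^sup>+x. f (\<chi> i. x i) \<partial>Pi\<^sub>M UNIV (\<lambda>_. lborel))"
proof -
  have "(\<Sum>i\<in>UNIV. x i *\<^sub>R axis i 1) = (\<chi> i. x i)" for x :: "'n \<Rightarrow> real"
    by (simp add: vec_eq_iff axis_def if_distrib cong: if_cong)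
  then show ?thesis
    by (subst lborel_eq_distr_PiM_Basis[OF bij_betw_axis_Basis], subst nn_integral_distr) auto
qed

lemma borel_measurable_matrix_vector [measurable]:
  fixes C :: "real^'n^'m"
  shows "(*v) C \<in> borel_measurable borel"
  by (intro borel_measurable_continuous_onI linear_continuous_on linear_conv_bounded_linear[THEN iffD1]
      matrix_vector_mul_linear)

lemma nn_integral_density_const:
  assumes "M = density (distr M N T) (\<lambda>_. c)" "T \<in> measurable M N" "f \<in> borel_measurable N"
  shows "(\<integral>\<^sup>+x. f x \<partial>M) = c * (\<integral>\<^sup>+x. f (T x) \<partial>M)"
  by (subst assms(1)) (use assms(2,3) in \<open>simp add: nn_integral_density nn_integral_distr nn_integral_cmult\<close>)

text \<open>The formula is compatible with products of matrices, so it is proved on generators: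
  scalings by a diagonal matrix, coordinate swaps, which preserve the product measure, and shears,
  which are translations in one coordinate.\<close>

lemma nn_integral_matrix_vector:
  fixes C :: "real^'n^'n" and f :: "real^'n \<Rightarrow> ennreal"
  assumes "det C \<noteq> 0" "f \<in> borel_measurable borel"
  shows "(\<integral>\<^sup>+x. f x \<partial>lborel) = \<bar>det C\<bar> * (\<integral>\<^sup>+x. f (C *v x) \<partial>lborel)"
proof -
  \<comment> \<open>The quantifier over \<open>f\<close> is needed because the product case applies
    the second factor to f composed with the first. Keeping the determinant condition inside makes
    the case of a zero row vacuous.\<close>
  have "\<forall>f \<in> borel_measurable borel. det C \<noteq> 0 \<longrightarrow>
      (\<integral>\<^sup>+x. f x \<partial>lborel) = ennreal \<bar>det C\<bar> * (\<integral>\<^sup>+x. f (C *v x) \<partial>lborel)"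
  proof (induction C rule: induct_matrix_elementary)
    case (1 A B)
    show ?case
    proof (intro ballI impI)
      fix f :: "real^'n \<Rightarrow> ennreal" assume [measurable]: "f \<in> borel_measurable borel" and d: "det (A ** B) \<noteq> 0"
      then have d: "det A \<noteq> 0" "det B \<noteq> 0" by (auto simp: det_mul)
      have "(\<integral>\<^sup>+x. f x \<partial>lborel) = ennreal \<bar>det A\<bar> * (\<integral>\<^sup>+x. f (A *v x) \<partial>lborel)"
        by (rule 1(1)[rule_format]) (use d in auto)
      also have "(\<integral>\<^sup>+x. f (A *v x) \<partial>lborel) = ennreal \<bar>det B\<bar> * (\<integral>\<^sup>+x. f (A *v (B *v x)) \<partial>lborel)"
        by (rule 1(2)[rule_format]) (use d in auto)
      finally show "(\<integral>\<^sup>+x. f x \<partial>lborel) = ennreal \<bar>det (A ** B)\<bar> * (\<integral>\<^sup>+x. f (A ** B *v x) \<partial>lborel)"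
        by (simp add: det_mul abs_mult ennreal_mult mult.assoc matrix_vector_mul_assoc)
    qed
  next
    case (2 A i)
    then show ?case by (simp add: det_zero_row)
  next
    case (3 A)
    show ?case
    proof (intro ballI impI)
      fix f :: "real^'n \<Rightarrow> ennreal" assume [measurable]: "f \<in> borel_measurable borel" and d: "det A \<noteq> 0"
      define c where "c b = (\<Sum>i\<in>UNIV. A $ i $ i * b $ i)" for b :: "real^'n"
      have dA: "det A = (\<Prod>i\<in>UNIV. A $ i $ i)" using 3 by (rule det_diagonal)
      have c: "c (axis i 1) = A $ i $ i" for i
        by (simp add: c_def axis_def if_distrib cong: if_cong)
      have c0: "c j \<noteq> 0" if j: "j \<in> Basis" for j
      proof -
        obtain i where "j = axis i 1"
          using j by (auto simp: Basis_vec_def)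
        then show ?thesis using d by (simp add: c dA)
      qed
      have prod: "(\<Prod>j\<in>Basis. \<bar>c j\<bar>) = \<bar>det A\<bar>"
        by (subst prod.reindex_bij_betw[OF bij_betw_axis_Basis, symmetric]) (simp add: c dA abs_prod)
      have "0 + (\<Sum>j\<in>Basis. (c j * (x \<bullet> j)) *\<^sub>R j) = A *v x" for x
      proof -
        have "(\<Sum>j\<in>Basis. (c j * (x \<bullet> j)) *\<^sub>R j) = (\<Sum>i\<in>UNIV. (A $ i $ i * x $ i) *\<^sub>R axis i 1)"
          by (subst sum.reindex_bij_betw[OF bij_betw_axis_Basis, symmetric]) (simp add: c inner_axis)
        also have "\<dots> = (\<chi> i. A $ i $ i * x $ i)"
          by (simp add: vec_eq_iff axis_def if_distrib cong: if_cong)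
        also have "(\<chi> i. A $ i $ i * x $ i) = A *v x"
        proof -
          have "(\<Sum>j\<in>UNIV. A $ i $ j * x $ j) = (\<Sum>j\<in>UNIV. if i = j then A $ i $ i * x $ i else 0)" for i
            using 3 by (intro sum.cong) auto
          then show ?thesis by (simp add: vec_eq_iff matrix_vector_mult_def)
        qed
        finally show ?thesis by simp
      qed
      then have "lborel = density (distr lborel borel ((*v) A)) (\<lambda>_. ennreal \<bar>det A\<bar>)"
        using lborel_affine_euclidean[of c 0, OF c0] by (simp add: prod)
      then show "(\<integral>\<^sup>+x. f x \<partial>lborel) = ennreal \<bar>det A\<bar> * (\<integral>\<^sup>+x. f (A *v x) \<partial>lborel)"
        by (rule nn_integral_density_const) auto
    qed
  next
    case (4 m n)
    let ?M = "(\<chi> i j. mat 1 $ i $ Transposition.transpose m n j) :: real^'n^'n"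
    have M: "?M *v axis i 1 = axis (Transposition.transpose m n i) 1" for i
    proof -
      have "(?M *v x) $ k = x $ Transposition.transpose m n k" for x k
      proof -
        have "(?M *v x) $ k = (\<Sum>j\<in>UNIV. if j = Transposition.transpose m n k then x $ j else 0)"
          unfolding matrix_vector_mult_def vec_lambda_beta
          by (intro sum.cong) (auto simp: mat_def Transposition.transpose_def)
        then show ?thesis by simp
      qed
      then show ?thesis
        by (auto simp: vec_eq_iff axis_def Transposition.transpose_def)
    qed
    have "bij_betw ((*v) ?M) Basis Basis"
    proof -
      have "bij_betw (\<lambda>i. axis (Transposition.transpose m n i) (1::real)) UNIV (Basis :: (real^'n) set)"
        using bij_betw_trans[OF bij_transpose bij_betw_axis_Basis] by (simp add: o_def)
      then have "bij_betw (\<lambda>i. ?M *v axis i 1) UNIV (Basis :: (real^'n) set)" by (simp add: M)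
      then show ?thesis
        using bij_betw_comp_iff[OF bij_betw_axis_Basis, of "(*v) ?M" Basis] by (simp add: o_def)
    qed
    then have "distr lborel borel ((*v) ?M) = lborel"
      by (intro lborel_distr_bij_Basis matrix_vector_mul_linear)
    then have "lborel = density (distr lborel borel ((*v) ?M)) (\<lambda>_. 1)"
      by (simp add: density_1)
    then have "(\<integral>\<^sup>+x. f x \<partial>lborel) = 1 * (\<integral>\<^sup>+x. f (?M *v x) \<partial>lborel)" if "f \<in> borel_measurable borel" for f
      by (rule nn_integral_density_const) (use that in auto)
    moreover have "\<bar>det ?M\<bar> = 1"
      using det_elementary_swap[OF 4] by (metis abs_1 abs_minus)
    ultimately show ?case
      by (metis ennreal_1)
  next
    case (5 m n c)
    let ?M = "(\<chi> i j. if i = m \<and> j = n then c else of_bool (i = j)) :: real^'n^'n"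
    have M: "(?M *v x) = (\<chi> i. if i = m then x $ m + c * x $ n else x $ i)" for x
    proof -
      have "(?M *v x) $ i = (if i = m then x $ m + c * x $ n else x $ i)" for i
      proof -
        have "(?M *v x) $ i = (\<Sum>j\<in>UNIV. (if j = i then x $ i else 0) + (if j = n then (if i = m then c * x $ n else 0) else 0))"
          unfolding matrix_vector_mult_def vec_lambda_beta using 5 by (intro sum.cong) auto
        then show ?thesis by (simp add: sum.distrib)
      qed
      then show ?thesis by (simp add: vec_eq_iff)
    qed
    show ?case
    proof (intro ballI impI)
      fix f :: "real^'n \<Rightarrow> ennreal" assume f[measurable]: "f \<in> borel_measurable borel"
      interpret product_sigma_finite "\<lambda>_::'n. lborel :: real measure" ..
      have U: "UNIV = insert m (UNIV - {m})" by auto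
      have "(\<integral>\<^sup>+x. f (?M *v x) \<partial>lborel)
          = (\<integral>\<^sup>+x. f (?M *v (\<chi> i. x i)) \<partial>Pi\<^sub>M (insert m (UNIV - {m})) (\<lambda>_. lborel))"
        by (subst nn_integral_lborel_vec) (simp_all flip: U)
      also have "\<dots> = (\<integral>\<^sup>+x. \<integral>\<^sup>+y. f (?M *v (\<chi> i. (x(m := y)) i)) \<partial>lborel \<partial>Pi\<^sub>M (UNIV - {m}) (\<lambda>_. lborel))"
        by (rule product_nn_integral_insert) auto
      also have "\<dots> = (\<integral>\<^sup>+x. \<integral>\<^sup>+y. f (\<chi> i. (x(m := y)) i) \<partial>lborel \<partial>Pi\<^sub>M (UNIV - {m}) (\<lambda>_. lborel))"
      proof (rule nn_integral_cong)
        fix x :: "'n \<Rightarrow> real"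
        \<comment> \<open>With coordinate \<open>m\<close> innermost and all others fixed, the shear
          only translates \<open>y\<close> by the constant \<open>c * x n\<close>, as
          \<open>n\<close> differs from \<open>m\<close>. The slope 1 is written out to fit the
          affine substitution rule.\<close>
        have e: "?M *v (\<chi> i. (x(m := y)) i) = (\<chi> i. (x(m := c * x n + 1 * y)) i)" for y
          using 5 by (auto simp: M vec_eq_iff)
        have "(\<lambda>y. (x(m := y)) i) \<in> borel_measurable borel" for i
          by (cases "i = m") auto
        then have fm: "(\<lambda>y. f (\<chi> i. (x(m := y)) i)) \<in> borel_measurable borel"
          by (intro measurable_compose[OF _ f] borel_measurable_vec_lambda)
        show "(\<integral>\<^sup>+y. f (?M *v (\<chi> i. (x(m := y)) i)) \<partial>lborel) = (\<integral>\<^sup>+y. f (\<chi> i. (x(m := y)) i) \<partial>lborel)"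
          unfolding e using nn_integral_real_affine[OF fm one_neq_zero, of "c * x n"]
          by (simp only: abs_one ennreal_1 mult_1_left)
      qed
      also have "\<dots> = (\<integral>\<^sup>+x. f (\<chi> i. x i) \<partial>Pi\<^sub>M (insert m (UNIV - {m})) (\<lambda>_. lborel))"
        by (rule product_nn_integral_insert[symmetric]) auto
      also have "\<dots> = (\<integral>\<^sup>+x. f x \<partial>lborel)"
        by (subst nn_integral_lborel_vec) (simp_all flip: U)
      finally show "(\<integral>\<^sup>+x. f x \<partial>lborel) = ennreal \<bar>det ?M\<bar> * (\<integral>\<^sup>+x. f (?M *v x) \<partial>lborel)"
        using det_elementary_add[OF 5, of c] by simp
    qed
  qed
  then show ?thesis using assms by blast
qed

section \<open>Integrating a determinant power over rank-one downdates\<close>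

text \<open>Restriction of the complex duplication formula; z > 0 keeps both arguments away from the
  poles.\<close>

lemma Gamma_legendre_duplication_real:
  fixes z :: real
  assumes "z > 0"
  shows "Gamma z * Gamma (z + 1/2) = 2 powr (1 - 2 * z) * sqrt pi * Gamma (2 * z)"
proof -
  have "complex_of_real (Gamma z * Gamma (z + 1/2)) = Gamma (of_real z) * Gamma (of_real z + 1/2)"
    using Gamma_complex_of_real[of "z + 1/2"] by (simp add: Gamma_complex_of_real)
  also have "\<dots> = exp ((1 - 2 * of_real z) * of_real (ln 2)) * of_real (sqrt pi) * Gamma (2 * of_real z)"
  proof (rule Gamma_legendre_duplication)
    show "complex_of_real z \<notin> \<int>\<^sub>\<le>\<^sub>0" "complex_of_real z + 1/2 \<notin> \<int>\<^sub>\<le>\<^sub>0"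
      using assms by (auto elim!: nonpos_Ints_cases simp: complex_eq_iff)
  qed
  also have "\<dots> = of_real (exp ((1 - 2 * z) * ln 2) * sqrt pi * Gamma (2 * z))"
    using Gamma_complex_of_real[of "2 * z"] by (simp flip: exp_of_real)
  finally show ?thesis
    unfolding of_real_eq_iff by (simp add: powr_def)
qed

text \<open>Scalar counterpart of \<open>det_powr\<close>: the cut-off restricts an integral of a
  power of c - |x|^2 to the open ball.\<close>

definition pos_powr :: "real \<Rightarrow> real \<Rightarrow> real" where
  "pos_powr a c = (if c > 0 then c powr a else 0)"

lemma borel_measurable_pos_powr [measurable]: "pos_powr a \<in> borel_measurable borel"
  unfolding pos_powr_def[abs_def] by measurable

lemma pos_powr_nonneg [simp]: "pos_powr a c \<ge> 0"
  by (simp add: pos_powr_def)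

text \<open>The substitution \<open>t = \<surd>c (2 s - 1)\<close> gives \<open>Beta(a + 1, a + 1)\<close>; Legendre duplication then
  produces the constant.\<close>

lemma nn_integral_pos_powr_minus_square:
  fixes a c :: real
  assumes a: "a > -1"
  shows "(\<integral>\<^sup>+t. pos_powr a (c - t\<^sup>2) \<partial>lborel)
    = ennreal (sqrt pi * Gamma (a + 1) / Gamma (a + 3/2) * pos_powr (a + 1/2) c)"
proof (cases "c > 0")
  case False
  then have "\<not> c - t\<^sup>2 > 0" for t
    using zero_le_power2[of t] by linarith
  then have "pos_powr a (c - t\<^sup>2) = 0" for t
    unfolding pos_powr_def by (rule if_not_P)
  with False show ?thesis by (simp add: pos_powr_def)
next
  case True
  have "(\<integral>\<^sup>+t. pos_powr a (c - t\<^sup>2) \<partial>lborel)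
      = ennreal \<bar>2 * sqrt c\<bar> * (\<integral>\<^sup>+s. pos_powr a (c - (- sqrt c + 2 * sqrt c * s)\<^sup>2) \<partial>lborel)"
    using True by (intro nn_integral_real_affine) auto
  also have "(\<lambda>s. pos_powr a (c - (- sqrt c + 2 * sqrt c * s)\<^sup>2))
      = (\<lambda>s. (4 * c) powr a * (s powr (a + 1 - 1) * (1 - s) powr (a + 1 - 1) * indicator {0<..<1} s))"
  proof
    fix s :: real
    have e: "c - (- sqrt c + 2 * sqrt c * s)\<^sup>2 = 4 * c * (s * (1 - s))"
      using True by (simp add: power2_sum power_mult_distrib) (simp add: algebra_simps power2_eq_square)
    have "0 < 4 * c * (s * (1 - s)) \<longleftrightarrow> s \<in> {0<..<1}"
      using True by (auto simp: zero_less_mult_iff)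
    then show "pos_powr a (c - (- sqrt c + 2 * sqrt c * s)\<^sup>2)
        = (4 * c) powr a * (s powr (a + 1 - 1) * (1 - s) powr (a + 1 - 1) * indicator {0<..<1} s)"
      unfolding e using True by (simp add: pos_powr_def powr_mult)
  qed
  also have "(\<integral>\<^sup>+s. ennreal ((4 * c) powr a * (s powr (a + 1 - 1) * (1 - s) powr (a + 1 - 1) * indicator {0<..<1} s)) \<partial>lborel)
      = ennreal ((4 * c) powr a) * (\<integral>\<^sup>+s. ennreal (s powr (a + 1 - 1) * (1 - s) powr (a + 1 - 1) * indicator {0<..<1} s) \<partial>lborel)"
    by (simp add: ennreal_mult nn_integral_cmult)
  also have "(\<integral>\<^sup>+s. ennreal (s powr (a + 1 - 1) * (1 - s) powr (a + 1 - 1) * indicator {0<..<1} s) \<partial>lborel)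
      = ennreal (Beta (a + 1) (a + 1))"
  proof (rule nn_integral_has_integral_lborel)
    have "((\<lambda>s. s powr (a + 1 - 1) * (1 - s) powr (a + 1 - 1)) has_integral Beta (a + 1) (a + 1)) {0<..<1}"
      using has_integral_Beta_real[of "a + 1" "a + 1"] a by (simp add: has_integral_Icc_iff_Ioo)
    then show "((\<lambda>s. s powr (a + 1 - 1) * (1 - s) powr (a + 1 - 1) * indicator {0<..<1} s) has_integral Beta (a + 1) (a + 1)) UNIV"
      by (subst (asm) has_integral_restrict_UNIV[symmetric]) (simp add: indicator_def of_bool_def if_distrib cong: if_cong)
  qed (auto simp: indicator_def)
  also have "ennreal \<bar>2 * sqrt c\<bar> * (ennreal ((4 * c) powr a) * ennreal (Beta (a + 1) (a + 1)))
      = ennreal (2 * sqrt c * ((4 * c) powr a * Beta (a + 1) (a + 1)))"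
    using True by (simp only: ennreal_mult'[symmetric] powr_ge_zero abs_ge_zero)
      (simp add: abs_mult)
  also have "2 * sqrt c * ((4 * c) powr a * Beta (a + 1) (a + 1))
      = sqrt pi * Gamma (a + 1) / Gamma (a + 3/2) * c powr (a + 1/2)"
  proof -
    have pos: "Gamma (a + 1) > 0" "Gamma (a + 3/2) > 0" "Gamma (2 * a + 2) > 0"
      using a by (auto intro!: Gamma_real_pos)
    have dup: "Gamma (a + 1) * Gamma (a + 3/2) = 2 powr (- 1 - 2 * a) * sqrt pi * Gamma (2 * a + 2)"
      using Gamma_legendre_duplication_real[of "a + 1"] a by (simp add: algebra_simps)
    \<comment> \<open>The power of two from the duplication formula cancels the Jacobian factor 2
      together with the \<open>4 powr a\<close> coming from \<open>(4 * c) powr a\<close>.\<close>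
    have four: "2 powr (- 1 - 2 * a) * (2 * 4 powr a) = (1::real)"
    proof -
      have "(4::real) powr a = 2 powr (2 * a)"
        using powr_powr[of 2 2 a] by simp
      then have "2 powr (- 1 - 2 * a) * (2 * 4 powr a) = (2::real) powr ((- 1 - 2 * a) + (1 + 2 * a))"
        unfolding powr_add by simp
      then show ?thesis by simp
    qed
    have "Beta (a + 1) (a + 1) = Gamma (a + 1) * Gamma (a + 1) / Gamma (2 * a + 2)"
      by (simp add: Beta_def algebra_simps)
    also have "\<dots> = (Gamma (a + 1) * Gamma (a + 3/2)) * Gamma (a + 1) / (Gamma (a + 3/2) * Gamma (2 * a + 2))"
      using pos by simp
    also have "\<dots> = 2 powr (- 1 - 2 * a) * (sqrt pi * Gamma (a + 1) / Gamma (a + 3/2))"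
      unfolding dup using pos by simp
    finally have "2 * 4 powr a * Beta (a + 1) (a + 1)
        = (2 powr (- 1 - 2 * a) * (2 * 4 powr a)) * (sqrt pi * Gamma (a + 1) / Gamma (a + 3/2))"
      by simp
    then have beta: "2 * 4 powr a * Beta (a + 1) (a + 1) = sqrt pi * Gamma (a + 1) / Gamma (a + 3/2)"
      unfolding four by simp
    have "sqrt c * (4 * c) powr a = 4 powr a * c powr (a + 1/2)"
      using True by (simp add: powr_mult powr_add powr_half_sqrt)
    then have "2 * sqrt c * ((4 * c) powr a * Beta (a + 1) (a + 1))
        = (2 * 4 powr a * Beta (a + 1) (a + 1)) * c powr (a + 1/2)"
      by (simp add: mult_ac)
    then show ?thesis unfolding beta .
  qed
  finally show ?thesis using True by (simp add: pos_powr_def)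
qed

text \<open>Integrating out one coordinate contributes sqrt(pi) Gamma(a+1) / Gamma(a+3/2) and raises
  the exponent by 1/2, so consecutive Gamma factors cancel. The exponent is arbitrary in the
  induction because the hypothesis is used at a + 1/2.\<close>

lemma nn_integral_PiM_pos_powr:
  fixes a c :: real and J :: "'j set"
  assumes "finite J" and "a > -1"
  shows "(\<integral>\<^sup>+x. pos_powr a (c - (\<Sum>j\<in>J. (x j)\<^sup>2)) \<partial>Pi\<^sub>M J (\<lambda>_. lborel))
    = ennreal (pi powr (card J / 2) * Gamma (a + 1) / Gamma (a + 1 + card J / 2) * pos_powr (a + card J / 2) c)"
  using assms
proof (induction J arbitrary: a rule: finite_induct)
  case empty
  then have "Gamma (a + 1) > 0" by (intro Gamma_real_pos) auto
  then show ?case by (simp add: PiM_empty nn_integral_count_space_finite)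
next
  case (insert i J)
  interpret product_sigma_finite "\<lambda>_. lborel :: real measure" ..
  define \<kappa> where "\<kappa> = sqrt pi * Gamma (a + 1) / Gamma (a + 3/2)"
  have pos: "Gamma (a + 3/2) > 0" "Gamma (a + 1) > 0"
    using insert.prems by (auto intro!: Gamma_real_pos)
  then have \<kappa>: "\<kappa> \<ge> 0" by (simp add: \<kappa>_def)
  have "(\<integral>\<^sup>+x. pos_powr a (c - (\<Sum>j\<in>insert i J. (x j)\<^sup>2)) \<partial>Pi\<^sub>M (insert i J) (\<lambda>_. lborel))
      = (\<integral>\<^sup>+x. \<integral>\<^sup>+y. pos_powr a (c - (\<Sum>j\<in>insert i J. ((x(i := y)) j)\<^sup>2)) \<partial>lborel \<partial>Pi\<^sub>M J (\<lambda>_. lborel))"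
    using insert.hyps by (intro product_nn_integral_insert) auto
  also have "\<dots> = (\<integral>\<^sup>+x. \<integral>\<^sup>+y. pos_powr a ((c - (\<Sum>j\<in>J. (x j)\<^sup>2)) - y\<^sup>2) \<partial>lborel \<partial>Pi\<^sub>M J (\<lambda>_. lborel))"
  proof -
    have "c - (\<Sum>j\<in>insert i J. ((x(i := y)) j)\<^sup>2) = (c - (\<Sum>j\<in>J. (x j)\<^sup>2)) - y\<^sup>2" for x :: "'j \<Rightarrow> real" and y
    proof -
      have "(\<Sum>j\<in>J. ((x(i := y)) j)\<^sup>2) = (\<Sum>j\<in>J. (x j)\<^sup>2)"
        using insert.hyps by (intro sum.cong) auto
      then show ?thesis
        unfolding sum.insert[OF insert.hyps] fun_upd_same by simp
    qed
    then show ?thesis by (simp only:)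
  qed
  \<comment> \<open>The one-dimensional formula is used with \<open>c\<close> minus the remaining
    squares in place of \<open>c\<close>. It holds for either sign of that number, so no case
    distinction arises.\<close>
  also have "\<dots> = (\<integral>\<^sup>+x. ennreal \<kappa> * pos_powr (a + 1/2) (c - (\<Sum>j\<in>J. (x j)\<^sup>2)) \<partial>Pi\<^sub>M J (\<lambda>_. lborel))"
    unfolding nn_integral_pos_powr_minus_square[OF insert.prems] \<kappa>_def[symmetric] ennreal_mult'[OF \<kappa>] ..
  also have "\<dots> = ennreal \<kappa> * ennreal (pi powr (card J / 2) * Gamma (a + 1/2 + 1) / Gamma (a + 1/2 + 1 + card J / 2)
      * pos_powr (a + 1/2 + card J / 2) c)"
    using insert.prems by (subst nn_integral_cmult) (simp_all add: insert.IH[of "a + 1/2"])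
  also have "\<dots> = ennreal (\<kappa> * (pi powr (card J / 2) * Gamma (a + 1/2 + 1) / Gamma (a + 1/2 + 1 + card J / 2)
      * pos_powr (a + 1/2 + card J / 2) c))"
    by (rule ennreal_mult'[OF \<kappa>, symmetric])
  also have "\<kappa> * (pi powr (card J / 2) * Gamma (a + 1/2 + 1) / Gamma (a + 1/2 + 1 + card J / 2)
      * pos_powr (a + 1/2 + card J / 2) c)
    = pi powr (card (insert i J) / 2) * Gamma (a + 1) / Gamma (a + 1 + card (insert i J) / 2)
      * pos_powr (a + card (insert i J) / 2) c"
  proof -
    have "a + 1/2 + 1 = a + 3/2" "a + 1/2 + card J / 2 = a + card (insert i J) / 2"
      "a + 3/2 + card J / 2 = a + 1 + card (insert i J) / 2"
      using insert.hyps by (auto simp: field_simps)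
    moreover have "pi powr (card (insert i J) / 2) = sqrt pi * pi powr (card J / 2)"
      using insert.hyps by (simp add: add_divide_distrib powr_add powr_half_sqrt)
    ultimately show ?thesis
      using pos by (simp only: \<kappa>_def) simp
  qed
  finally show ?case .
qed

text \<open>The integral of (1 - |u|^2)^a over the unit ball of R^q.\<close>

definition ball_const :: "nat \<Rightarrow> real \<Rightarrow> real" where
  "ball_const q a = pi powr (real q / 2) * Gamma (a + 1) / Gamma (a + 1 + q / 2)"

lemma ball_const_pos: "a > -1 \<Longrightarrow> ball_const q a > 0"
  unfolding ball_const_def by (intro divide_pos_pos mult_pos_pos Gamma_real_pos) auto

lemma nn_integral_det_powr_minus_outer:
  fixes B :: "real^'q^'q"
  assumes a: "a > -1"
  shows "(\<integral>\<^sup>+x. det_powr a (B - outer x) \<partial>lborel) = ennreal (ball_const CARD('q) a * det_powr (a + 1/2) B)"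
proof (cases "pos_def B")
  case False
  then have "det_powr a (B - outer x) = 0" for x
    using pos_def_minus_outerD[of B x] by (auto simp: det_powr_def)
  then show ?thesis using False by (simp add: det_powr_def)
next
  case True
  then obtain C :: "real^'q^'q" where C: "invertible C" "B = C ** transpose C"
    by (rule pos_def_factorization)
  have [measurable]: "(\<lambda>x. B - outer x) \<in> borel_measurable borel"
    unfolding outer_def by (intro borel_measurable_diff borel_measurable_vec_lambda) auto
  have det: "det B = (det C)\<^sup>2" by (simp add: C det_mul power2_eq_square)
  have "(\<integral>\<^sup>+x. det_powr a (B - outer x) \<partial>lborel)
      = ennreal \<bar>det C\<bar> * (\<integral>\<^sup>+u. det_powr a (B - outer (C *v u)) \<partial>lborel)"
    using C(1) by (intro nn_integral_matrix_vector) (auto simp: invertible_det_nz)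
  also have "(\<lambda>u. det_powr a (B - outer (C *v u))) = (\<lambda>u. det_powr a B * pos_powr a (1 - (\<Sum>i\<in>UNIV. (u $ i)\<^sup>2)))"
    by (auto simp: fun_eq_iff C(2) det_powr_minus_outer[OF C(1)] pos_powr_def inner_vec_def power2_eq_square)
  also have "(\<integral>\<^sup>+(u::real^'q). det_powr a B * pos_powr a (1 - (\<Sum>i\<in>UNIV. (u $ i)\<^sup>2)) \<partial>lborel)
      = det_powr a B * ennreal (ball_const CARD('q) a)"
  proof -
    have "(\<integral>\<^sup>+(u::real^'q). pos_powr a (1 - (\<Sum>i\<in>UNIV. (u $ i)\<^sup>2)) \<partial>lborel) = ball_const CARD('q) a"
      using nn_integral_PiM_pos_powr[of "UNIV :: 'q set" a 1] a
      by (subst nn_integral_lborel_vec) (simp_all add: ball_const_def pos_powr_def[of _ 1])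
    then show ?thesis
      by (simp add: ennreal_mult nn_integral_cmult det_powr_def)
  qed
  also have "ennreal \<bar>det C\<bar> * (det_powr a B * ennreal (ball_const CARD('q) a))
      = ennreal (\<bar>det C\<bar> * (det_powr a B * ball_const CARD('q) a))"
    using ball_const_pos[OF a] by (simp add: ennreal_mult det_powr_def less_imp_le)
  \<comment> \<open>The Jacobian |det C| is the square root of det B, which accounts for the
    increase of the exponent by 1/2.\<close>
  also have "\<bar>det C\<bar> * (det_powr a B * ball_const CARD('q) a) = ball_const CARD('q) a * det_powr (a + 1/2) B"
    using True pos_def_det_pos[OF True] by (simp add: det_powr_def powr_add powr_half_sqrt det)
  finally show ?thesis .
qed

lemma borel_measurable_sum_outer [measurable]:
  assumes "\<And>j. j \<in> J \<Longrightarrow> (\<lambda>w. x w j) \<in> borel_measurable M"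
  shows "(\<lambda>w. \<Sum>j\<in>J. outer (x w j :: real^'q)) \<in> borel_measurable M"
proof (rule borel_measurable_sum)
  fix j assume "j \<in> J"
  from assms[OF this] have [measurable]: "(\<lambda>w. x w j) \<in> borel_measurable M" .
  show "(\<lambda>w. outer (x w j)) \<in> borel_measurable M"
    unfolding outer_def by (intro borel_measurable_vec_lambda) auto
qed

text \<open>Each integrated row leaves the next one with an exponent larger by 1/2; hence the shifts
  k/2 in the constants and the total shift by half the number of rows.\<close>

lemma nn_integral_PiM_det_powr:
  fixes S :: "real^'q^'q" and J :: "'j set"
  assumes "finite J" and "a > -1"
  shows "(\<integral>\<^sup>+x. det_powr a (S - (\<Sum>j\<in>J. outer (x j))) \<partial>Pi\<^sub>M J (\<lambda>_. lborel))
    = ennreal ((\<Prod>k<card J. ball_const CARD('q) (a + real k / 2)) * det_powr (a + card J / 2) S)"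
  using assms
proof (induction J arbitrary: a rule: finite_induct)
  case empty
  then show ?case by (simp add: PiM_empty nn_integral_count_space_finite)
next
  case (insert i J)
  interpret product_sigma_finite "\<lambda>_. lborel :: (real^'q) measure" ..
  have pos: "ball_const CARD('q) a > 0" using insert.prems by (rule ball_const_pos)
  have "(\<integral>\<^sup>+x. det_powr a (S - (\<Sum>j\<in>insert i J. outer (x j))) \<partial>Pi\<^sub>M (insert i J) (\<lambda>_. lborel))
      = (\<integral>\<^sup>+x. \<integral>\<^sup>+y. det_powr a (S - (\<Sum>j\<in>insert i J. outer ((x(i := y)) j))) \<partial>lborel \<partial>Pi\<^sub>M J (\<lambda>_. lborel))"
  proof (rule product_nn_integral_insert[OF insert.hyps])
    have [measurable]: "(\<lambda>x. \<Sum>j\<in>insert i J. outer (x j)) \<in> borel_measurable (Pi\<^sub>M (insert i J) (\<lambda>_. lborel))"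
      by (intro borel_measurable_sum_outer) simp
    show "(\<lambda>x. ennreal (det_powr a (S - (\<Sum>j\<in>insert i J. outer (x j))))) \<in> borel_measurable (Pi\<^sub>M (insert i J) (\<lambda>_. lborel))"
      by measurable
  qed
  also have "\<dots> = (\<integral>\<^sup>+x. \<integral>\<^sup>+y. det_powr a ((S - (\<Sum>j\<in>J. outer (x j))) - outer y) \<partial>lborel \<partial>Pi\<^sub>M J (\<lambda>_. lborel))"
  proof -
    have "S - (\<Sum>j\<in>insert i J. outer ((x(i := y)) j)) = (S - (\<Sum>j\<in>J. outer (x j))) - outer y"
      for x :: "'j \<Rightarrow> real^'q" and y
    proof -
      have "(\<Sum>j\<in>J. outer ((x(i := y)) j)) = (\<Sum>j\<in>J. outer (x j))"
        using insert.hyps by (intro sum.cong) auto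
      then show ?thesis
        unfolding sum.insert[OF insert.hyps] fun_upd_same by simp
    qed
    then show ?thesis by (simp only:)
  qed
  also have "\<dots> = (\<integral>\<^sup>+x. ennreal (ball_const CARD('q) a) * det_powr (a + 1/2) (S - (\<Sum>j\<in>J. outer (x j))) \<partial>Pi\<^sub>M J (\<lambda>_. lborel))"
    using insert.prems pos by (simp add: nn_integral_det_powr_minus_outer ennreal_mult')
  also have "\<dots> = ennreal (ball_const CARD('q) a)
      * ennreal ((\<Prod>k<card J. ball_const CARD('q) (a + 1/2 + real k / 2)) * det_powr (a + 1/2 + card J / 2) S)"
    using insert.prems by (subst nn_integral_cmult) (simp_all add: insert.IH[of "a + 1/2"])
  also have "\<dots> = ennreal (ball_const CARD('q) a
      * ((\<Prod>k<card J. ball_const CARD('q) (a + 1/2 + real k / 2)) * det_powr (a + 1/2 + card J / 2) S))"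
    using pos by (simp add: ennreal_mult')
  \<comment> \<open>The factor of the row just removed is the term k = 0; the induction hypothesis
    at a + 1/2 supplies the terms with k shifted by one.\<close>
  also have "ball_const CARD('q) a
      * ((\<Prod>k<card J. ball_const CARD('q) (a + 1/2 + real k / 2)) * det_powr (a + 1/2 + card J / 2) S)
    = (\<Prod>k<card (insert i J). ball_const CARD('q) (a + real k / 2)) * det_powr (a + card (insert i J) / 2) S"
    using insert.hyps
    by (simp add: prod.lessThan_Suc_shift add_divide_distrib add.assoc del: prod.lessThan_Suc)
  finally show ?case .
qed

section \<open>Integrals over rectangular matrices\<close>

lemma bij_betw_axis_Basis_vec:
  "bij_betw (\<lambda>(i, u). axis i u) (UNIV \<times> Basis) (Basis :: ('e::euclidean_space^'n) set)"
  unfolding bij_betw_def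
proof
  show "inj_on (\<lambda>(i::'n, u::'e). axis i u) (UNIV \<times> Basis)"
    by (auto simp: inj_on_def axis_eq_axis)
qed (auto simp: Basis_vec_def)

text \<open>A matrix is integrated as a family of rows, each carrying the Lebesgue measure of a
  vector space, because the row induction removes whole vectors and not scalar coordinates.\<close>

lemma nn_integral_lborel_rows:
  fixes f :: "'e::euclidean_space^'n \<Rightarrow> ennreal"
  assumes [measurable]: "f \<in> borel_measurable borel"
  shows "(\<integral>\<^sup>+x. f x \<partial>lborel) = (\<integral>\<^sup>+x. f (\<chi> i. x i) \<partial>Pi\<^sub>M UNIV (\<lambda>_. lborel))"
proof -
  interpret product_sigma_finite "\<lambda>_::'n. lborel :: 'e measure" ..
  have [measurable]: "vec_lambda \<in> borel_measurable (Pi\<^sub>M UNIV (\<lambda>_::'n. lborel :: 'e measure))"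
    by (rule borel_measurable_vec_lambda) simp
  have "lborel = distr (Pi\<^sub>M UNIV (\<lambda>_::'n. lborel :: 'e measure)) borel vec_lambda"
  proof (rule lborel_eqI)
    fix l u :: "'e^'n" assume le: "\<And>b. b \<in> Basis \<Longrightarrow> l \<bullet> b \<le> u \<bullet> b"
    then have le': "l $ i \<bullet> b \<le> u $ i \<bullet> b" if "b \<in> Basis" for i b
      using that le[of "axis i b"] by (simp add: inner_axis)
    have "vec_lambda -` box l u \<inter> space (Pi\<^sub>M UNIV (\<lambda>_::'n. lborel :: 'e measure)) = Pi\<^sub>E UNIV (\<lambda>i. box (l $ i) (u $ i))"
      by (auto simp: space_PiM PiE_iff box_def Basis_vec_def inner_axis)
    then have "emeasure (distr (Pi\<^sub>M UNIV (\<lambda>_::'n. lborel :: 'e measure)) borel vec_lambda) (box l u)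
        = (\<Prod>i\<in>UNIV. emeasure lborel (box (l $ i) (u $ i)))"
      by (subst emeasure_distr) (auto simp: emeasure_PiM)
    also have "\<dots> = (\<Prod>i\<in>UNIV. ennreal (\<Prod>b\<in>Basis. (u $ i - l $ i) \<bullet> b))"
      by (simp add: emeasure_lborel_box le')
    also have "\<dots> = ennreal (\<Prod>i\<in>UNIV. \<Prod>b\<in>Basis. (u $ i - l $ i) \<bullet> b)"
      by (intro prod_ennreal prod_nonneg) (auto simp: inner_diff_left le')
    also have "(\<Prod>i\<in>UNIV. \<Prod>b\<in>Basis. (u $ i - l $ i) \<bullet> b) = (\<Prod>b\<in>Basis. (u - l) \<bullet> b)"
      by (subst prod.reindex_bij_betw[OF bij_betw_axis_Basis_vec, symmetric])
        (simp add: prod.cartesian_product case_prod_unfold inner_axis)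
    finally show "emeasure (distr (Pi\<^sub>M UNIV (\<lambda>_::'n. lborel :: 'e measure)) borel vec_lambda) (box l u)
        = (\<Prod>b\<in>Basis. (u - l) \<bullet> b)" .
  qed simp
  then show ?thesis
    by (subst \<open>lborel = distr _ _ _\<close>, subst nn_integral_distr) auto
qed

section \<open>Transposition and left multiplication as changes of variables\<close>

lemma linear_transpose: "linear (transpose :: real^'n^'m \<Rightarrow> real^'m^'n)"
  by (rule linearI) (simp_all add: transpose_def vec_eq_iff)

lemma borel_measurable_transpose [measurable]:
  "(transpose :: real^'n^'m \<Rightarrow> real^'m^'n) \<in> borel_measurable borel"
  by (intro borel_measurable_continuous_onI linear_continuous_on linear_conv_bounded_linear[THEN iffD1]
      linear_transpose)

lemma transpose_Basis: "transpose ` (Basis :: (real^'n^'m) set) \<subseteq> Basis"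
proof
  fix y assume "y \<in> transpose ` (Basis :: (real^'n^'m) set)"
  then obtain i j where "y = transpose (axis i (axis j 1) :: real^'n^'m)"
    by (auto simp: Basis_vec_def)
  also have "\<dots> = axis j (axis i 1)"
    by (auto simp: transpose_def axis_def vec_eq_iff)
  finally show "y \<in> Basis" by (simp add: axis_in_Basis_iff)
qed

lemma lborel_distr_transpose: "distr lborel borel (transpose :: real^'n^'m \<Rightarrow> real^'m^'n) = lborel"
proof (rule lborel_distr_bij_Basis[OF linear_transpose])
  show "bij_betw (transpose :: real^'n^'m \<Rightarrow> real^'m^'n) Basis Basis"
    by (rule bij_betw_byWitness[where f' = transpose]) (simp_all add: transpose_Basis)
qed

lemma nn_integral_transpose:
  fixes f :: "real^'m^'n \<Rightarrow> ennreal"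
  assumes [measurable]: "f \<in> borel_measurable borel"
  shows "(\<integral>\<^sup>+x. f (transpose x) \<partial>lborel) = (\<integral>\<^sup>+x. f x \<partial>lborel)"
  by (subst (2) lborel_distr_transpose[symmetric], subst nn_integral_distr) auto

lemma borel_measurable_matrix_mult [measurable (raw)]:
  fixes f :: "'x \<Rightarrow> real^'k^'m" and g :: "'x \<Rightarrow> real^'n^'k"
  assumes [measurable]: "f \<in> borel_measurable M" "g \<in> borel_measurable M"
  shows "(\<lambda>x. f x ** g x) \<in> borel_measurable M"
  unfolding matrix_matrix_mult_def by (intro borel_measurable_vec_lambda) measurable

text \<open>On a product set every factor is scaled by |det C| through the vector formula, and
  product sets determine the product measure.\<close>

lemma PiM_lborel_matrix_vector:
  fixes C :: "real^'n^'n" and J :: "'j set"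
  assumes "finite J" "det C \<noteq> 0"
  shows "Pi\<^sub>M J (\<lambda>_. lborel) = density (distr (Pi\<^sub>M J (\<lambda>_. lborel)) (Pi\<^sub>M J (\<lambda>_. lborel)) (\<lambda>x. \<lambda>j\<in>J. C *v x j))
    (\<lambda>_. ennreal (\<bar>det C\<bar> ^ card J))" (is "_ = density (distr ?P ?P ?T) _")
proof -
  interpret product_sigma_finite "\<lambda>_::'j. lborel :: (real^'n) measure" ..
  have [measurable]: "?T \<in> ?P \<rightarrow>\<^sub>M ?P"
    by (intro measurable_restrict measurable_compose[OF _ borel_measurable_matrix_vector[of C]]
        measurable_compose[OF measurable_component_singleton]) auto
  have "density (distr ?P ?P ?T) (\<lambda>_. ennreal (\<bar>det C\<bar> ^ card J)) = ?P"
  proof (rule PiM_eqI)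
    fix X :: "'j \<Rightarrow> (real^'n) set" assume X: "\<And>j. j \<in> J \<Longrightarrow> X j \<in> sets lborel"
    have em: "emeasure lborel (X j) = ennreal \<bar>det C\<bar> * emeasure lborel ((*v) C -` X j)" if "j \<in> J" for j
    proof -
      have [measurable]: "X j \<in> sets borel" using X[OF that] by simp
      then have [measurable]: "(*v) C -` X j \<in> sets borel"
        using measurable_sets[OF borel_measurable_matrix_vector[of C], of "X j"] by simp
      have "(\<integral>\<^sup>+x. indicator (X j) x \<partial>lborel) = \<bar>det C\<bar> * (\<integral>\<^sup>+x. indicator (X j) (C *v x) \<partial>lborel)"
        by (rule nn_integral_matrix_vector) (use assms in auto)
      also have "(\<lambda>x. indicator (X j) (C *v x) :: ennreal) = indicator ((*v) C -` X j)"
        by (auto simp: indicator_def)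
      finally show ?thesis by simp
    qed
    have vs: "(*v) C -` X j \<in> sets lborel" if "j \<in> J" for j
      using measurable_sets[OF borel_measurable_matrix_vector[of C], of "X j"] X[OF that] by simp
    have "?T -` Pi\<^sub>E J X \<inter> space ?P = Pi\<^sub>E J (\<lambda>j. (*v) C -` X j)"
      by (auto simp: space_PiM PiE_iff)
    then have "emeasure (distr ?P ?P ?T) (Pi\<^sub>E J X) = (\<Prod>j\<in>J. emeasure lborel ((*v) C -` X j))"
      using X vs assms(1) by (subst emeasure_distr) (auto simp: emeasure_PiM intro!: sets_PiM_I_finite)
    then have "emeasure (density (distr ?P ?P ?T) (\<lambda>_. ennreal (\<bar>det C\<bar> ^ card J))) (Pi\<^sub>E J X)
        = ennreal (\<bar>det C\<bar> ^ card J) * (\<Prod>j\<in>J. emeasure lborel ((*v) C -` X j))"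
      using X assms(1) by (subst emeasure_density_const) (auto intro!: sets_PiM_I_finite)
    also have "\<dots> = (\<Prod>j\<in>J. emeasure lborel (X j))"
      by (simp add: em prod.distrib ennreal_power)
    finally show "emeasure (density (distr ?P ?P ?T) (\<lambda>_. ennreal (\<bar>det C\<bar> ^ card J))) (Pi\<^sub>E J X)
      = (\<Prod>j\<in>J. emeasure lborel (X j))" .
  qed (use assms in auto)
  then show ?thesis ..
qed

text \<open>Left multiplication acts on the columns of \<open>X\<close>. Transposing turns columns
  into rows, where the product decomposition applies, and each of the \<open>CARD('b)\<close>
  columns contributes one factor |det C|.\<close>

lemma nn_integral_matrix_left_mult:
  fixes C :: "real^'a^'a" and f :: "real^'b^'a \<Rightarrow> ennreal"
  assumes C: "det C \<noteq> 0" and [measurable]: "f \<in> borel_measurable borel"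
  shows "(\<integral>\<^sup>+Y. f Y \<partial>lborel) = ennreal (\<bar>det C\<bar> ^ CARD('b)) * (\<integral>\<^sup>+X. f (C ** X) \<partial>lborel)"
proof -
  let ?P = "Pi\<^sub>M UNIV (\<lambda>_::'b. lborel :: (real^'a) measure)"
  have [measurable]: "vec_lambda \<in> borel_measurable ?P"
    by (rule borel_measurable_vec_lambda) simp
  have T[measurable]: "(\<lambda>x. \<lambda>j\<in>UNIV. C *v x j) \<in> ?P \<rightarrow>\<^sub>M ?P"
    by (intro measurable_restrict measurable_compose[OF _ borel_measurable_matrix_vector[of C]]
        measurable_compose[OF measurable_component_singleton]) auto
  have "(\<integral>\<^sup>+Y. f Y \<partial>lborel) = (\<integral>\<^sup>+Y. f (transpose Y) \<partial>lborel)"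
    by (simp add: nn_integral_transpose)
  also have "\<dots> = (\<integral>\<^sup>+x. f (transpose (\<chi> j. x j)) \<partial>?P)"
    by (rule nn_integral_lborel_rows) measurable
  also have "\<dots> = ennreal (\<bar>det C\<bar> ^ CARD('b)) * (\<integral>\<^sup>+x. f (transpose (\<chi> j. C *v x j)) \<partial>?P)"
    using nn_integral_density_const[OF PiM_lborel_matrix_vector[OF finite C, of UNIV] T,
        of "\<lambda>x. f (transpose (\<chi> j. x j))"] by simp
  also have "(\<lambda>x. f (transpose (\<chi> j. C *v x j))) = (\<lambda>x. f (C ** transpose (\<chi> j. x j)))"
    by (intro ext arg_cong[where f = f])
      (simp add: vec_eq_iff transpose_def matrix_matrix_mult_def matrix_vector_mult_def)
  also have "(\<integral>\<^sup>+x. f (C ** transpose (\<chi> j. x j)) \<partial>?P) = (\<integral>\<^sup>+X. f (C ** transpose X) \<partial>lborel)"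
    by (rule nn_integral_lborel_rows[symmetric]) measurable
  also have "\<dots> = (\<integral>\<^sup>+X. f (C ** X) \<partial>lborel)"
    by (rule nn_integral_transpose) measurable
  finally show ?thesis .
qed

lemma transpose_mult_self_eq_sum_outer:
  fixes X :: "real^'b^'a"
  shows "transpose X ** X = (\<Sum>i\<in>UNIV. outer (X $ i))"
  by (simp add: vec_eq_iff outer_def matrix_matrix_mult_def transpose_def)

text \<open>The power of det A is the Jacobian of Y = C X: one factor |det C| = (det A)^(1/2) per
  column of Y. When \<open>D\<close> is not positive definite both sides are zero.\<close>

lemma nn_integral_det_powr_schur:
  fixes A :: "real^'a^'a" and D :: "real^'b^'b"
  assumes A: "pos_def A" and a: "a > -1"
  shows "(\<integral>\<^sup>+Y. det_powr a (D - transpose Y ** matrix_inv A ** Y) \<partial>lborel)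
    = ennreal ((\<Prod>k<CARD('a). ball_const CARD('b) (a + real k / 2)) * det A powr (CARD('b) / 2)
        * det_powr (a + CARD('a) / 2) D)"
proof -
  obtain C :: "real^'a^'a" where C: "invertible C" "A = C ** transpose C"
    using A by (rule pos_def_factorization)
  define E where "E = matrix_inv C"
  have E: "C ** E = mat 1" "E ** C = mat 1"
    using matrix_inv_inverse[OF C(1)] by (auto simp: E_def)
  have "transpose C ** transpose E = mat 1"
    by (simp add: E flip: matrix_transpose_mul)
  then have "A ** (transpose E ** E) = mat 1"
    by (metis C(2) E(1) matrix_mul_assoc matrix_mul_rid)
  then have inv: "matrix_inv A = transpose E ** E" by (rule matrix_inv_eqI)
  have YY: "transpose (C ** X) ** matrix_inv A ** (C ** X) = (\<Sum>i\<in>UNIV. outer (X $ i))" for X :: "real^'b^'a"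
  proof -
    have "transpose (C ** X) ** matrix_inv A ** (C ** X) = transpose X ** (transpose (E ** C) ** (E ** C)) ** X"
      by (simp add: inv matrix_transpose_mul matrix_mul_assoc)
    then show ?thesis by (simp add: E transpose_mult_self_eq_sum_outer)
  qed
  have detC: "det C \<noteq> 0" using C(1) by (simp add: invertible_det_nz)
  have [measurable]: "(\<lambda>X::real^'b^'a. \<Sum>i\<in>UNIV. outer (X $ i)) \<in> borel_measurable borel"
    by (intro borel_measurable_sum_outer) simp
  have "(\<integral>\<^sup>+Y. det_powr a (D - transpose Y ** matrix_inv A ** Y) \<partial>lborel)
      = ennreal (\<bar>det C\<bar> ^ CARD('b)) * (\<integral>\<^sup>+X. det_powr a (D - transpose (C ** X) ** matrix_inv A ** (C ** X)) \<partial>lborel)"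
    by (rule nn_integral_matrix_left_mult[OF detC]) measurable
  also have "\<dots> = ennreal (\<bar>det C\<bar> ^ CARD('b)) * (\<integral>\<^sup>+(X::real^'b^'a). det_powr a (D - (\<Sum>i\<in>UNIV. outer (X $ i))) \<partial>lborel)"
    by (simp only: YY)
  also have "(\<integral>\<^sup>+(X::real^'b^'a). det_powr a (D - (\<Sum>i\<in>UNIV. outer (X $ i))) \<partial>lborel)
      = (\<integral>\<^sup>+x. det_powr a (D - (\<Sum>i\<in>UNIV. outer (x i))) \<partial>Pi\<^sub>M (UNIV :: 'a set) (\<lambda>_. lborel))"
    by (subst nn_integral_lborel_rows) simp_all
  also have "\<dots> = ennreal ((\<Prod>k<CARD('a). ball_const CARD('b) (a + real k / 2)) * det_powr (a + CARD('a) / 2) D)"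
    by (rule nn_integral_PiM_det_powr[OF finite a])
  also have "ennreal (\<bar>det C\<bar> ^ CARD('b)) * ennreal ((\<Prod>k<CARD('a). ball_const CARD('b) (a + real k / 2)) * det_powr (a + CARD('a) / 2) D)
      = ennreal (\<bar>det C\<bar> ^ CARD('b) * ((\<Prod>k<CARD('a). ball_const CARD('b) (a + real k / 2)) * det_powr (a + CARD('a) / 2) D))"
    by (rule ennreal_mult'[symmetric]) simp
  also have "\<bar>det C\<bar> ^ CARD('b) = det A powr (CARD('b) / 2)"
  proof -
    have "det A = \<bar>det C\<bar> powr 2" using detC by (simp add: C det_mul powr_numeral power2_eq_square)
    then have "det A powr (CARD('b) / 2) = \<bar>det C\<bar> powr CARD('b)"
      by (simp only: powr_powr) simp
    then show ?thesis using detC by (simp add: powr_realpow)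
  qed
  finally show ?thesis by (simp add: mult_ac)
qed

section \<open>The normalizing constant in terms of the multivariate gamma function\<close>

lemma prod_lessThan_add:
  fixes f :: "nat \<Rightarrow> real"
  shows "(\<Prod>i<m + q. f i) = (\<Prod>i<m. f i) * (\<Prod>i<q. f (m + i))"
  by (induction q) simp_all

text \<open>The definition lists the Gamma arguments in descending half steps from the largest.
  Reversing the order lists them upwards from the smallest argument \<open>y\<close>, the form in
  which products are compared below.\<close>

lemma mv_gamma_shift:
  "mv_gamma q (y + (real q - 1) / 2) = pi powr (real q * (real q - 1) / 4) * (\<Prod>i<q. Gamma (y + real i / 2))"
proof -
  have "(\<Prod>j = 1..q. Gamma (y + (real q - 1) / 2 - (real j - 1) / 2))
      = (\<Prod>j<q. Gamma (y + (real q - 1) / 2 - (real (Suc j) - 1) / 2))"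
    by (simp add: prod.atLeast1_atMost_eq)
  also have "\<dots> = (\<Prod>j<q. Gamma (y + real (q - Suc j) / 2))"
    by (intro prod.cong arg_cong[where f = Gamma]) (auto simp: field_simps of_nat_diff)
  also have "\<dots> = (\<Prod>i<q. Gamma (y + real i / 2))"
    by (rule prod.nat_diff_reindex)
  finally show ?thesis by (simp add: mv_gamma_def)
qed

lemma mv_gamma_pos:
  assumes "x > (real q - 1) / 2"
  shows "mv_gamma q x > 0"
  unfolding mv_gamma_def using assms by (intro mult_pos_pos prod_pos) (auto intro!: Gamma_real_pos)

text \<open>Integration over m rows produces m Gamma quotients, while the expected constant has q
  factors in numerator and denominator. With G(r) the product of Gamma(a + 1 + i/2) over i < r, the
  product G(m + q) splits off either its first m or its first q factors; comparing the two
  splittings exchanges the roles of m and q.\<close>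

lemma prod_ball_const:
  assumes "a > -1"
  shows "(\<Prod>k<m. ball_const q (a + real k / 2))
    = pi powr (real m * real q / 2) * mv_gamma q (a + 1 + (real q - 1) / 2)
      / mv_gamma q (a + 1 + real m / 2 + (real q - 1) / 2)"
proof -
  have pos: "(\<Prod>i<r. Gamma (a + 1 + x / 2 + real i / 2)) > 0" if "x \<ge> 0" for r x
    using that assms by (intro prod_pos) (auto intro!: Gamma_real_pos)
  let ?G = "\<lambda>r. \<Prod>i<r. Gamma (a + 1 + real i / 2)"
  have split: "?G (r + s) = ?G r * (\<Prod>i<s. Gamma (a + 1 + real r / 2 + real i / 2))" for r s
    using prod_lessThan_add[of "\<lambda>i. Gamma (a + 1 + real i / 2)" r s]
    by (simp add: add_divide_distrib add.assoc)
  have "(\<Prod>k<m. ball_const q (a + real k / 2))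
      = (\<Prod>k<m. pi powr (real q / 2)) * ?G m / (\<Prod>k<m. Gamma (a + 1 + real q / 2 + real k / 2))"
    by (simp add: ball_const_def prod.distrib prod_dividef add_ac)
  also have "(\<Prod>k<m. pi powr (real q / 2)) = pi powr (real m * real q / 2)"
    by (simp add: powr_powr mult.commute flip: powr_realpow)
  also have "pi powr (real m * real q / 2) * ?G m / (\<Prod>k<m. Gamma (a + 1 + real q / 2 + real k / 2))
      = pi powr (real m * real q / 2) * ?G q / (\<Prod>i<q. Gamma (a + 1 + real m / 2 + real i / 2))"
  proof -
    have "?G m * (\<Prod>i<q. Gamma (a + 1 + real m / 2 + real i / 2)) = ?G q * (\<Prod>k<m. Gamma (a + 1 + real q / 2 + real k / 2))"
      using split[of m q] split[of q m] by (metis add.commute)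
    then have "?G m / (\<Prod>k<m. Gamma (a + 1 + real q / 2 + real k / 2)) = ?G q / (\<Prod>i<q. Gamma (a + 1 + real m / 2 + real i / 2))"
      using pos[of "real m" q] pos[of "real q" m] by (simp only: frac_eq_eq[OF less_imp_neq[symmetric] less_imp_neq[symmetric]] of_nat_0_le_iff)
    then show ?thesis unfolding times_divide_eq_right[symmetric] by simp
  qed
  also have "\<dots> = pi powr (real m * real q / 2) * mv_gamma q (a + 1 + (real q - 1) / 2)
      / mv_gamma q (a + 1 + real m / 2 + (real q - 1) / 2)"
    unfolding mv_gamma_shift by simp
  finally show ?thesis .
qed

section \<open>The Wishart density on a partitioned matrix\<close>

lemma matrix_inv_block_diagonal:
  assumes "invertible A" "invertible D"
  shows "matrix_inv (block_matrix A 0 0 D) = block_matrix (matrix_inv A) 0 0 (matrix_inv D)"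
  by (rule matrix_inv_eqI) (simp add: block_matrix_mult matrix_inv_inverse assms mat_1_block)

lemma trace_block_matrix: "trace (block_matrix A B C D) = trace A + trace D"
  by (simp add: trace_def sum_UNIV_Plus)

lemma wishart_const_pos:
  fixes S :: "real^'n^'n"
  assumes "pos_def S" "n \<ge> real CARD('n)"
  shows "2 powr (real CARD('n) * n / 2) * det S powr (n / 2) * mv_gamma CARD('n) (n / 2) > 0"
  using assms pos_def_det_pos[OF assms(1)] by (intro mult_pos_pos mv_gamma_pos) auto

lemma wishart_density_nonneg:
  fixes S :: "real^'n^'n"
  assumes "pos_def S" "n \<ge> real CARD('n)"
  shows "wishart_density n S X \<ge> 0"
  using wishart_const_pos[OF assms] by (simp add: wishart_density_def)

text \<open>The inverse of a block diagonal scale matrix is block diagonal, so the off-diagonal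
  block drops out of the trace. Everything else that does not involve \<open>Y\<close> or a power of
  a determinant is collected in \<open>c\<close>; only its positivity is recorded, since it cancels
  in the conditional density.\<close>

lemma wishart_density_block:
  fixes S11 :: "real^'a::finite^'a" and S22 :: "real^'b::finite^'b"
  assumes S: "S = block_matrix S11 0 0 S22" "pos_def S"
    and n: "n \<ge> real (CARD('a) + CARD('b))"
  obtains c :: "real^'a^'a \<Rightarrow> real^'b^'b \<Rightarrow> real"
  where "\<And>A D. c A D > 0"
    and "\<And>A D Y. wishart_density n S (block_matrix A Y (transpose Y) D) = (if pos_def A then
      c A D * det A powr ((n - real (CARD('a) + CARD('b)) - 1) / 2)
        * det_powr ((n - real (CARD('a) + CARD('b)) - 1) / 2) (D - transpose Y ** matrix_inv A ** Y) else 0)"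
proof -
  let ?\<alpha> = "(n - real (CARD('a) + CARD('b)) - 1) / 2"
  define Z where "Z = 2 powr (real CARD('a + 'b) * n / 2) * det S powr (n / 2) * mv_gamma CARD('a + 'b) (n / 2)"
  define c where "c A D = exp (- (1/2) * (trace (matrix_inv S11 ** A) + trace (matrix_inv S22 ** D))) / Z"
    for A :: "real^'a^'a" and D :: "real^'b^'b"
  have "Z > 0"
    unfolding Z_def using n by (intro wishart_const_pos[OF S(2)]) simp
  then have "c A D > 0" for A D by (simp add: c_def)
  moreover have "wishart_density n S (block_matrix A Y (transpose Y) D)
      = (if pos_def A then c A D * det A powr ?\<alpha> * det_powr ?\<alpha> (D - transpose Y ** matrix_inv A ** Y) else 0)" for A D Y
  proof (cases "pos_def (block_matrix A Y (transpose Y) D)")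
    case False
    \<comment> \<open>If \<open>A\<close> is positive definite, the Schur complement is not, so
      \<open>det_powr\<close> makes the right side zero too.\<close>
    then show ?thesis using schur_complement_11[of A Y D] by (auto simp: wishart_density_def det_powr_def)
  next
    case True
    then have A: "pos_def A" by (rule pos_def_block_imp_diagonal)
    have inv: "invertible S11" "invertible S22"
      using S by (auto simp: pos_def_block_diagonal intro: pos_def_invertible)
    have "trace (matrix_inv S ** block_matrix A Y (transpose Y) D)
        = trace (matrix_inv S11 ** A) + trace (matrix_inv S22 ** D)"
      by (simp add: S(1) matrix_inv_block_diagonal[OF inv] block_matrix_mult trace_block_matrix)
    moreover have pd: "pos_def (D - transpose Y ** matrix_inv A ** Y)"
      using True schur_complement_11(2)[OF A] by blast
    moreover have "det (block_matrix A Y (transpose Y) D) powr ?\<alpha>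
        = det A powr ?\<alpha> * det (D - transpose Y ** matrix_inv A ** Y) powr ?\<alpha>"
      using pos_def_det_pos[OF A] pos_def_det_pos[OF pd] by (simp add: schur_complement_11(1)[OF A] powr_mult)
    ultimately show ?thesis
      using True A by (simp add: wishart_density_def c_def Z_def det_powr_def diff_diff_eq)
  qed
  ultimately show ?thesis by (rule that)
qed

lemma det_powr_nonneg [simp]: "det_powr a B \<ge> 0"
  by (simp add: det_powr_def)

lemma wishart_diag_blocks_density:
  fixes S11 :: "real^'a::finite^'a" and S22 :: "real^'b::finite^'b" and A :: "real^'a^'a" and D :: "real^'b^'b"
  assumes S: "S = block_matrix S11 0 0 S22" "pos_def S"
    and n: "n \<ge> real (CARD('a) + CARD('b))"
  defines "\<alpha> \<equiv> (n - real (CARD('a) + CARD('b)) - 1) / 2"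
  defines "p \<equiv> wishart_density n S"
  shows "(\<integral>\<^sup>+Y. ennreal (p (block_matrix A Y (transpose Y) D)) \<partial>lborel) = ennreal (diag_blocks_density p A D)"
    and "pos_def A \<Longrightarrow> pos_def D \<Longrightarrow> diag_blocks_density p A D > 0"
    and "\<not> (pos_def A \<and> pos_def D) \<Longrightarrow> diag_blocks_density p A D = 0"
    and "pos_def A \<Longrightarrow> pos_def D \<Longrightarrow> conditional_density p Y A D
      = det_powr \<alpha> (D - transpose Y ** matrix_inv A ** Y)
        / ((\<Prod>k<CARD('a). ball_const CARD('b) (\<alpha> + real k / 2)) * det A powr (CARD('b) / 2)
           * det D powr (\<alpha> + CARD('a) / 2))"
proof -
  obtain c :: "real^'a^'a \<Rightarrow> real^'b^'b \<Rightarrow> real" where c: "\<And>A D. c A D > 0"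
    and p: "\<And>A D Y. p (block_matrix A Y (transpose Y) D) = (if pos_def A then
      c A D * det A powr \<alpha> * det_powr \<alpha> (D - transpose Y ** matrix_inv A ** Y) else 0)"
    by (rule wishart_density_block[OF S n, folded \<alpha>_def p_def]) (rule that; assumption)
  define K where "K = (\<Prod>k<CARD('a). ball_const CARD('b) (\<alpha> + real k / 2))"
  have \<alpha>: "\<alpha> > -1" using n by (simp add: \<alpha>_def)
  have K: "K > 0" unfolding K_def using \<alpha> by (intro prod_pos ball_const_pos) (auto intro: less_le_trans)
  have p0: "p (block_matrix A Y (transpose Y) D) \<ge> 0" for Y
    using c by (simp add: p less_imp_le)
  have [measurable]: "(\<lambda>Y. p (block_matrix A Y (transpose Y) D)) \<in> borel_measurable borel"
    unfolding p by measurable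
  define m where "m = (if pos_def A then c A D * det A powr \<alpha>
      * (K * det A powr (CARD('b) / 2) * det_powr (\<alpha> + CARD('a) / 2) D) else 0)"
  have m0: "m \<ge> 0" using c[of A D] K by (simp add: m_def less_imp_le)
  have nn: "(\<integral>\<^sup>+Y. ennreal (p (block_matrix A Y (transpose Y) D)) \<partial>lborel) = ennreal m"
  proof (cases "pos_def A")
    case True
    have c0: "c A D * det A powr \<alpha> \<ge> 0" using c[of A D] by simp
    have "(\<integral>\<^sup>+Y. ennreal (p (block_matrix A Y (transpose Y) D)) \<partial>lborel)
        = (\<integral>\<^sup>+Y. ennreal (c A D * det A powr \<alpha>) * ennreal (det_powr \<alpha> (D - transpose Y ** matrix_inv A ** Y)) \<partial>lborel)"
      using True by (simp only: p ennreal_mult'[OF c0] if_True)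
    also have "\<dots> = ennreal (c A D * det A powr \<alpha>)
        * (\<integral>\<^sup>+Y. ennreal (det_powr \<alpha> (D - transpose Y ** matrix_inv A ** Y)) \<partial>lborel)"
      by (rule nn_integral_cmult) measurable
    also have "\<dots> = ennreal m"
      unfolding nn_integral_det_powr_schur[OF True \<alpha>] ennreal_mult'[OF c0, symmetric]
      using True by (simp add: m_def K_def)
    finally show ?thesis .
  qed (simp add: p m_def)
  have m: "diag_blocks_density p A D = m"
    unfolding diag_blocks_density_def using m0 p0 by (intro integral_eq_nn_integral[THEN trans]) (auto simp: nn)
  show "(\<integral>\<^sup>+Y. ennreal (p (block_matrix A Y (transpose Y) D)) \<partial>lborel) = ennreal (diag_blocks_density p A D)"
    unfolding m nn ..
  show "pos_def A \<Longrightarrow> pos_def D \<Longrightarrow> diag_blocks_density p A D > 0"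
    using c[of A D] K pos_def_det_pos[of A] pos_def_det_pos[of D] by (simp add: m m_def det_powr_def)
  show "\<not> (pos_def A \<and> pos_def D) \<Longrightarrow> diag_blocks_density p A D = 0"
    by (auto simp: m m_def det_powr_def)
  show "pos_def A \<Longrightarrow> pos_def D \<Longrightarrow> conditional_density p Y A D
      = det_powr \<alpha> (D - transpose Y ** matrix_inv A ** Y)
        / ((\<Prod>k<CARD('a). ball_const CARD('b) (\<alpha> + real k / 2)) * det A powr (CARD('b) / 2)
           * det D powr (\<alpha> + CARD('a) / 2))"
    using c[of A D] pos_def_det_pos[of A]
    by (simp add: conditional_density_def m m_def p det_powr_def[of _ D] flip: K_def)
qed

lemma det_mat_1_minus:
  fixes D M :: "real^'n^'n"
  assumes "pos_def D"
  shows "det (mat 1 - matrix_inv D ** M) = det (D - M) / det D"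
proof -
  note inv = matrix_inv_inverse[OF pos_def_invertible[OF assms]]
  have "D ** (mat 1 - matrix_inv D ** M) = D - M"
    by (simp add: matrix_mult_diff_distrib matrix_mul_assoc inv)
  then have "det D * det (mat 1 - matrix_inv D ** M) = det (D - M)"
    by (metis det_mul)
  then show ?thesis using pos_def_det_pos[OF assms] by (simp add: field_simps)
qed

text \<open>With M = Y^T A^-1 Y, det(D - M) = det D det(I - D^-1 M). Its power \<alpha> therefore
  cancels the \<open>det D powr \<alpha>\<close> of the marginal and leaves the power -l1/2 of det D
  required by the inverted t density.\<close>

lemma wishart_conditional_density:
  fixes S11 :: "real^'a::finite^'a" and S22 :: "real^'b::finite^'b" and A :: "real^'a^'a" and D :: "real^'b^'b"
  assumes S: "S = block_matrix S11 0 0 S22" "pos_def S"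
    and n: "n \<ge> real (CARD('a) + CARD('b))"
    and A: "pos_def A" and D: "pos_def D"
  shows "conditional_density (wishart_density n S) Y A D
      = inv_matrix_t_density (n - real (CARD('a) + CARD('b)) + 1) 0 D A (transpose Y)" (is ?T)
    and "pos_def (block_matrix A Y (transpose Y) D) \<Longrightarrow> conditional_density (wishart_density n S) Y A D
      = (mv_gamma CARD('b) (n / 2) / mv_gamma CARD('b) ((n - real CARD('a)) / 2)
         * (1 / (pi powr (real CARD('a) * real CARD('b) / 2)
                 * det A powr ((n - real CARD('a) - 1) / 2)
                 * det D powr ((n - real CARD('b) - 1) / 2))))
        * (det A * det D * det (mat 1 - matrix_inv D ** transpose Y ** matrix_inv A ** Y))
            powr ((n - real (CARD('a) + CARD('b)) - 1) / 2)" (is "_ \<Longrightarrow> ?Z")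
proof -
  define \<alpha> where "\<alpha> = (n - real (CARD('a) + CARD('b)) - 1) / 2"
  define M where "M = transpose Y ** matrix_inv A ** Y"
  define g where "g = mv_gamma CARD('b) ((n - real CARD('a)) / 2)"
  define h where "h = mv_gamma CARD('b) (n / 2)"
  have \<alpha>: "\<alpha> > -1" using n by (simp add: \<alpha>_def)
  have gh: "g > 0" "h > 0" unfolding g_def h_def using n by (auto intro!: mv_gamma_pos)
  have "(\<Prod>k<CARD('a). ball_const CARD('b) (\<alpha> + real k / 2)) = pi powr (real CARD('a) * real CARD('b) / 2) * g / h"
  proof -
    have "\<alpha> + 1 + (real CARD('b) - 1) / 2 = (n - real CARD('a)) / 2"
      "\<alpha> + 1 + real CARD('a) / 2 + (real CARD('b) - 1) / 2 = n / 2"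
      by (simp_all add: \<alpha>_def field_simps)
    then show ?thesis unfolding prod_ball_const[OF \<alpha>] g_def h_def by (simp only:)
  qed
  then have cd: "conditional_density (wishart_density n S) Y A D = det_powr \<alpha> (D - M)
        / (pi powr (real CARD('a) * real CARD('b) / 2) * g / h * det A powr (CARD('b) / 2)
           * det D powr (\<alpha> + CARD('a) / 2))"
    using wishart_diag_blocks_density(4)[OF S n A D, of Y] by (simp add: \<alpha>_def M_def)
  have d: "det A > 0" "det D > 0" using A D by (auto intro: pos_def_det_pos)
  have det: "det (mat 1 - matrix_inv D ** transpose Y ** matrix_inv A ** Y) = det (D - M) / det D"
    using det_mat_1_minus[OF D, of M] by (simp add: M_def matrix_mul_assoc)
  show ?T
  proof (cases "pos_def (D - M)")
    case True
    then have "det (D - M) > 0" by (rule pos_def_det_pos)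
    \<comment> \<open>The degrees of freedom n - l + 1 are chosen so that (\<nu> - 2)/2 is the
      Wishart exponent \<alpha>; the two Gamma arguments then become n/2 and (n - l1)/2.\<close>
    moreover have e: "(n - real (CARD('a) + CARD('b)) + 1 + real CARD('a) + real CARD('b) - 1) / 2 = n / 2"
      "(n - real (CARD('a) + CARD('b)) + 1 + real CARD('b) - 1) / 2 = (n - real CARD('a)) / 2"
      "(n - real (CARD('a) + CARD('b)) + 1 - 2) / 2 = \<alpha>"
      by (simp_all add: \<alpha>_def)
    ultimately show ?thesis
      unfolding cd inv_matrix_t_density_def diff_zero transpose_transpose det M_def[symmetric] e g_def[symmetric] h_def[symmetric]
        powr_add[of "det D" \<alpha>]
      using True d gh
      by (simp add: det_powr_def powr_divide powr_minus minus_divide_left[symmetric] divide_simps mult.commute[of "real CARD('b)"])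
  next
    case False
    then show ?thesis
      unfolding cd inv_matrix_t_density_def diff_zero transpose_transpose M_def[symmetric]
      by (simp add: det_powr_def)
  qed
  show ?Z if "pos_def (block_matrix A Y (transpose Y) D)"
  proof -
    have pd: "pos_def (D - M)" using that schur_complement_11(2)[OF A, of Y D] by (simp add: M_def)
    then have "det (D - M) > 0" by (rule pos_def_det_pos)
    \<comment> \<open>The powers of det A and det D in Z exceed those of the marginal constant by
      \<alpha> in the case of A; this \<alpha>-part cancels against the factor (det A det
      D)^\<alpha> of the product form.\<close>
    moreover have e: "(n - real CARD('a) - 1) / 2 = \<alpha> + CARD('b) / 2" "(n - real CARD('b) - 1) / 2 = \<alpha> + CARD('a) / 2"
      by (simp_all add: \<alpha>_def field_simps)
    ultimately show ?thesis
      unfolding cd det \<alpha>_def[symmetric] g_def[symmetric] h_def[symmetric] e powr_add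
      using pd d gh by (simp add: det_powr_def powr_mult) (simp add: mult_ac)
  qed
qed

section \<open>Lebesgue measure on partitioned symmetric matrices\<close>

definition sym_pairs :: "'n set set" where
  "sym_pairs = {{i, j} | i j. True}"

definition sym_matrix :: "('n::finite set \<Rightarrow> real) \<Rightarrow> real^'n^'n" where
  "sym_matrix f = (\<chi> i j. f {i, j})"

lemma finite_sym_pairs [simp]: "finite (sym_pairs :: 'n::finite set set)"
  by (rule finite_subset[of _ UNIV]) auto

lemma pair_in_sym_pairs [simp]: "{i, j} \<in> sym_pairs"
  by (auto simp: sym_pairs_def)

lemma lborel_sym_eq: "lborel_sym = distr (Pi\<^sub>M sym_pairs (\<lambda>_. lborel)) borel sym_matrix"
  by (simp add: lborel_sym_def sym_pairs_def sym_matrix_def[abs_def])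

lemma sets_lborel_sym [simp, measurable_cong]: "sets lborel_sym = sets borel"
  by (simp add: lborel_sym_def)

lemma space_lborel_sym [simp]: "space lborel_sym = UNIV"
  by (simp add: lborel_sym_def)

lemma borel_measurable_sym_matrix [measurable]:
  "sym_matrix \<in> borel_measurable (Pi\<^sub>M sym_pairs (\<lambda>_. lborel))"
  unfolding sym_matrix_def[abs_def]
  by (intro borel_measurable_vec_lambda measurable_component_singleton[THEN measurable_compose]) auto

text \<open>A pushforward need not inherit sigma-finiteness. Here \<open>sym_matrix\<close> has a
  measurable left inverse \<open>D\<close>, which reads the entry of each unordered pair at a chosen
  representative; pushing forward along \<open>D\<close> recovers the product measure, and
  sigma-finiteness of an image measure passes back to its source.\<close>

lemma sigma_finite_lborel_sym: "sigma_finite_measure (lborel_sym :: (real^'n^'n) measure)"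
proof -
  interpret product_sigma_finite "\<lambda>_::'n set. lborel :: real measure" ..
  let ?P = "Pi\<^sub>M sym_pairs (\<lambda>_::'n set. lborel :: real measure)"
  have "\<forall>s\<in>sym_pairs. \<exists>i j::'n. s = {i, j}"
    by (auto simp: sym_pairs_def)
  then obtain r c where rc: "\<And>s. s \<in> sym_pairs \<Longrightarrow> s = {r s, c s :: 'n}"
    by metis
  define D :: "real^'n^'n \<Rightarrow> 'n set \<Rightarrow> real" where "D A = (\<lambda>s\<in>sym_pairs. A $ r s $ c s)" for A
  have [measurable]: "D \<in> borel \<rightarrow>\<^sub>M ?P"
    unfolding D_def[abs_def] by (rule measurable_restrict) measurable
  have "D (sym_matrix f) = f" if "f \<in> space ?P" for f
    using that rc by (auto simp: D_def sym_matrix_def space_PiM PiE_def extensional_def fun_eq_iff)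
  then have "distr ?P ?P (\<lambda>f. D (sym_matrix f)) = distr ?P ?P (\<lambda>f. f)"
    by (intro distr_cong) auto
  then have "distr lborel_sym ?P D = ?P"
    by (simp add: lborel_sym_eq distr_distr o_def)
  moreover have "sigma_finite_measure ?P"
    by (rule sigma_finite) simp
  ultimately show ?thesis
    by (intro sigma_finite_measure_distr[of lborel_sym ?P D]) auto
qed

lemma lborel_matrix_eq_distr_PiM:
  "lborel = distr (Pi\<^sub>M UNIV (\<lambda>_. lborel)) borel (\<lambda>h. \<chi> i j. h (i, j) :: real^'n^'m)"
proof -
  have "bij_betw (\<lambda>(i::'m, j::'n). axis i (axis j (1::real))) UNIV (Basis :: (real^'n^'m) set)"
    by (auto simp: bij_betw_def inj_on_def axis_eq_axis Basis_vec_def)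
  from lborel_eq_distr_PiM_Basis[OF this]
  have "lborel = distr (Pi\<^sub>M UNIV (\<lambda>_::'m \<times> 'n. lborel)) borel
      (\<lambda>f. \<Sum>i\<in>UNIV. f i *\<^sub>R (case i of (i, j) \<Rightarrow> axis i (axis j 1)) :: real^'n^'m)" .
  moreover have "(\<Sum>k\<in>UNIV. f k *\<^sub>R (case k of (i, j) \<Rightarrow> axis i (axis j 1))) = (\<chi> i j. f (i, j) :: real^'n^'m)"
    for f :: "'m \<times> 'n \<Rightarrow> real"
  proof -
    have "(\<Sum>k\<in>UNIV. f k *\<^sub>R (case k of (i, j) \<Rightarrow> axis i (axis j (1::real)))) $ i $ j
        = (\<Sum>k\<in>UNIV. if k = (i, j) then f k else 0)" for i j
      by (simp add: case_prod_unfold del: sum.delta sum.delta') (intro sum.cong, auto simp: axis_def)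
    then show ?thesis by (simp add: vec_eq_iff)
  qed
  ultimately show ?thesis by simp
qed

text \<open>A pair is inside the left summand, inside the right one, or mixed. Mixed pairs are
  labelled (j, i), right index first, to match the rows and columns of A12^T.\<close>

lemma sym_pairs_Plus:
  "(sym_pairs :: ('a + 'b) set set)
    = (`) Inl ` sym_pairs \<union> (`) Inr ` sym_pairs \<union> (\<lambda>(j, i). {Inl i, Inr j}) ` UNIV" (is "?L = ?R")
proof
  show "?L \<subseteq> ?R"
  proof
    fix s :: "('a + 'b) set" assume "s \<in> sym_pairs"
    then obtain x y where s: "s = {x, y}" by (auto simp: sym_pairs_def)
    show "s \<in> ?R"
    proof (cases x; cases y)
      fix i i' assume "x = Inl i" "y = Inl i'"
      then have "s = Inl ` {i, i'}" by (simp add: s)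
      then show ?thesis by (intro UnI1 image_eqI[of _ _ "{i, i'}"]) auto
    next
      fix j j' assume "x = Inr j" "y = Inr j'"
      then have "s = Inr ` {j, j'}" by (simp add: s)
      then show ?thesis by (intro UnI1 UnI2 image_eqI[of _ _ "{j, j'}"]) auto
    next
      fix i j assume "x = Inl i" "y = Inr j"
      then show ?thesis by (intro UnI2 image_eqI[of _ _ "(j, i)"]) (auto simp: s)
    next
      fix i j assume "x = Inr j" "y = Inl i"
      then show ?thesis by (intro UnI2 image_eqI[of _ _ "(j, i)"]) (auto simp: s)
    qed
  qed
  show "?R \<subseteq> ?L"
    by (auto simp: sym_pairs_def)
qed

text \<open>Glues coordinates of the three blocks into coordinates of the whole matrix. In a mixed
  pair the choices with \<open>SOME\<close> are unique, and the restriction to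
  \<open>sym_pairs\<close> makes the result extensional, as the product space demands.\<close>

definition merge_pairs ::
  "(('a set \<Rightarrow> real) \<times> ('b set \<Rightarrow> real)) \<times> ('b \<times> 'a \<Rightarrow> real) \<Rightarrow> ('a + 'b) set \<Rightarrow> real" where
  "merge_pairs x = (\<lambda>s\<in>sym_pairs. if s \<subseteq> range Inl then fst (fst x) (Inl -` s)
     else if s \<subseteq> range Inr then snd (fst x) (Inr -` s)
     else snd x (SOME j. Inr j \<in> s, SOME i. Inl i \<in> s))"

lemma merge_pairs_simps:
  "s \<in> sym_pairs \<Longrightarrow> merge_pairs ((f, g), h) (Inl ` s) = f s"
  "t \<in> sym_pairs \<Longrightarrow> merge_pairs ((f, g), h) (Inr ` t) = g t"
  "merge_pairs ((f, g), h) {Inl i, Inr j} = h (j, i)"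
proof -
  have [simp]: "Inl -` Inl ` s = s" "Inr -` Inr ` t = t" for s :: "'x set" and t :: "'y set"
    by auto
  show "s \<in> sym_pairs \<Longrightarrow> merge_pairs ((f, g), h) (Inl ` s) = f s"
    by (auto simp: merge_pairs_def sym_pairs_Plus)
  show "t \<in> sym_pairs \<Longrightarrow> merge_pairs ((f, g), h) (Inr ` t) = g t"
    by (auto simp: merge_pairs_def sym_pairs_Plus sym_pairs_def)
  show "merge_pairs ((f, g), h) {Inl i, Inr j} = h (j, i)"
    by (auto simp: merge_pairs_def)
qed

lemma sym_matrix_merge_pairs:
  "sym_matrix (merge_pairs ((f, g), h))
    = block_matrix (sym_matrix f) (transpose (\<chi> j i. h (j, i))) (\<chi> j i. h (j, i)) (sym_matrix g)"
proof -
  have "merge_pairs ((f, g), h) {Inl i, Inl i'} = f {i, i'}" for i i'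
    using merge_pairs_simps(1)[of "{i, i'}" f g h] by simp
  moreover have "merge_pairs ((f, g), h) {Inr j, Inr j'} = g {j, j'}" for j j'
    using merge_pairs_simps(2)[of "{j, j'}" f g h] by simp
  moreover have "merge_pairs ((f, g), h) {Inr j, Inl i} = h (j, i)" for i j
    using merge_pairs_simps(3)[of f g h i j] by (simp add: insert_commute)
  ultimately show ?thesis
    by (simp add: vec_eq_iff_sum vec_eq_iff sym_matrix_def merge_pairs_simps(3) transpose_def)
qed

lemma measurable_merge_pairs [measurable]:
  "merge_pairs \<in> (Pi\<^sub>M (sym_pairs :: 'a::finite set set) (\<lambda>_. lborel) \<Otimes>\<^sub>M Pi\<^sub>M (sym_pairs :: 'b::finite set set) (\<lambda>_. lborel))
      \<Otimes>\<^sub>M Pi\<^sub>M UNIV (\<lambda>_. lborel) \<rightarrow>\<^sub>M Pi\<^sub>M sym_pairs (\<lambda>_. lborel)" (is "_ \<in> ?M \<rightarrow>\<^sub>M _")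
proof (rule measurable_PiM_single')
  fix s :: "('a + 'b) set" assume s: "s \<in> sym_pairs"
  from s consider t where "t \<in> sym_pairs" "s = Inl ` t" | t where "t \<in> sym_pairs" "s = Inr ` t"
    | i j where "s = {Inl i, Inr j}"
    unfolding sym_pairs_Plus by auto
  then show "(\<lambda>x. merge_pairs x s) \<in> ?M \<rightarrow>\<^sub>M lborel"
  proof cases
    case 1
    then have eq: "(\<lambda>x. merge_pairs x s) = (\<lambda>x. fst (fst x) t)"
      by (auto simp: fun_eq_iff merge_pairs_simps)
    show ?thesis unfolding eq using \<open>t \<in> sym_pairs\<close> by measurable
  next
    case 2
    then have eq: "(\<lambda>x. merge_pairs x s) = (\<lambda>x. snd (fst x) t)"
      by (auto simp: fun_eq_iff merge_pairs_simps)
    show ?thesis unfolding eq using \<open>t \<in> sym_pairs\<close> by measurable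
  next
    case 3
    then have eq: "(\<lambda>x. merge_pairs x s) = (\<lambda>x. snd x (j, i))"
      by (auto simp: fun_eq_iff merge_pairs_simps)
    show ?thesis unfolding eq by measurable
  qed
qed (auto simp: merge_pairs_def space_PiM)

text \<open>The three kinds of pairs are disjoint and injectively parametrized, so on product sets
  the product over all pairs factors into three.\<close>

lemma PiM_sym_pairs_Plus:
  "Pi\<^sub>M sym_pairs (\<lambda>_. lborel) = distr
    ((Pi\<^sub>M (sym_pairs :: 'a::finite set set) (\<lambda>_. lborel) \<Otimes>\<^sub>M Pi\<^sub>M (sym_pairs :: 'b::finite set set) (\<lambda>_. lborel))
      \<Otimes>\<^sub>M Pi\<^sub>M UNIV (\<lambda>_. lborel)) (Pi\<^sub>M sym_pairs (\<lambda>_. lborel)) merge_pairs" (is "?P = distr ((?Pa \<Otimes>\<^sub>M ?Pb) \<Otimes>\<^sub>M ?N) _ _")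
proof -
  interpret a: product_sigma_finite "\<lambda>_::'a set. lborel :: real measure" ..
  interpret b: product_sigma_finite "\<lambda>_::'b set. lborel :: real measure" ..
  interpret n: product_sigma_finite "\<lambda>_::'b \<times> 'a. lborel :: real measure" ..
  interpret ab: product_sigma_finite "\<lambda>_::('a + 'b) set. lborel :: real measure" ..
  interpret Pb: sigma_finite_measure ?Pb by (rule b.sigma_finite) simp
  interpret N: sigma_finite_measure ?N by (rule n.sigma_finite) simp
  have "distr ((?Pa \<Otimes>\<^sub>M ?Pb) \<Otimes>\<^sub>M ?N) ?P merge_pairs = ?P"
  proof (rule ab.PiM_eqI)
    fix X :: "('a + 'b) set \<Rightarrow> real set" assume X: "\<And>s. s \<in> sym_pairs \<Longrightarrow> X s \<in> sets lborel"
    have XA: "X (Inl ` s) \<in> sets borel" if "s \<in> sym_pairs" for s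
      using X[of "Inl ` s"] that by (auto simp: sym_pairs_Plus)
    have XB: "X (Inr ` s) \<in> sets borel" if "s \<in> sym_pairs" for s
      using X[of "Inr ` s"] that by (auto simp: sym_pairs_Plus)
    have XC: "X {Inl i, Inr j} \<in> sets borel" for i j
      using X[of "{Inl i, Inr j}"] by simp
    let ?A = "Pi\<^sub>E sym_pairs (\<lambda>s. X (Inl ` s))" and ?B = "Pi\<^sub>E sym_pairs (\<lambda>s. X (Inr ` s))"
      and ?C = "Pi\<^sub>E UNIV (\<lambda>(j, i). X {Inl i, Inr j})"
    have "merge_pairs ((f, g), h) \<in> Pi\<^sub>E sym_pairs X \<longleftrightarrow>
        (\<forall>s\<in>sym_pairs. f s \<in> X (Inl ` s)) \<and> (\<forall>t\<in>sym_pairs. g t \<in> X (Inr ` t)) \<and> (\<forall>i j. h (j, i) \<in> X {Inl i, Inr j})"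
      for f g h
    proof -
      have "merge_pairs ((f, g), h) \<in> Pi\<^sub>E sym_pairs X \<longleftrightarrow> (\<forall>s\<in>sym_pairs. merge_pairs ((f, g), h) s \<in> X s)"
        by (auto simp: PiE_iff merge_pairs_def)
      also have "\<dots> \<longleftrightarrow> (\<forall>s\<in>sym_pairs. f s \<in> X (Inl ` s)) \<and> (\<forall>t\<in>sym_pairs. g t \<in> X (Inr ` t))
          \<and> (\<forall>i j. h (j, i) \<in> X {Inl i, Inr j})"
        unfolding sym_pairs_Plus ball_Un
        by (simp add: merge_pairs_simps) blast
      finally show ?thesis .
    qed
    then have "merge_pairs -` Pi\<^sub>E sym_pairs X \<inter> space ((?Pa \<Otimes>\<^sub>M ?Pb) \<Otimes>\<^sub>M ?N) = (?A \<times> ?B) \<times> ?C"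
      by (auto simp: space_pair_measure space_PiM PiE_iff)
    then have "emeasure (distr ((?Pa \<Otimes>\<^sub>M ?Pb) \<Otimes>\<^sub>M ?N) ?P merge_pairs) (Pi\<^sub>E sym_pairs X)
        = emeasure ((?Pa \<Otimes>\<^sub>M ?Pb) \<Otimes>\<^sub>M ?N) ((?A \<times> ?B) \<times> ?C)"
      using X by (subst emeasure_distr) (auto intro!: sets_PiM_I_finite)
    also have "\<dots> = emeasure ?Pa ?A * emeasure ?Pb ?B * emeasure ?N ?C"
    proof -
      have "?A \<in> sets ?Pa" "?B \<in> sets ?Pb"
        using XA XB by (auto intro!: sets_PiM_I_finite)
      moreover have "?C \<in> sets ?N"
        using XC by (intro sets_PiM_I_finite) auto
      ultimately show ?thesis
        by (simp add: N.emeasure_pair_measure_Times Pb.emeasure_pair_measure_Times)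
    qed
    also have "\<dots> = (\<Prod>s\<in>sym_pairs. emeasure lborel (X (Inl ` s))) * (\<Prod>s\<in>sym_pairs. emeasure lborel (X (Inr ` s)))
        * (\<Prod>(j, i)\<in>UNIV. emeasure lborel (X {Inl i, Inr j}))"
      using XA XB XC
      by (simp add: a.emeasure_PiM b.emeasure_PiM n.emeasure_PiM case_prod_unfold)
    also have "\<dots> = (\<Prod>s\<in>sym_pairs. emeasure lborel (X s))"
    proof -
      let ?I = "(`) Inl ` sym_pairs :: ('a + 'b) set set" and ?J = "(`) Inr ` sym_pairs :: ('a + 'b) set set"
        and ?K = "(\<lambda>(j, i). {Inl i, Inr j}) ` UNIV :: ('a + 'b) set set"
      have "?I \<inter> ?J = {}" "(?I \<union> ?J) \<inter> ?K = {}"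
        by (auto simp: sym_pairs_def)
      then have "(\<Prod>s\<in>sym_pairs. emeasure lborel (X s)) = prod (\<lambda>s. emeasure lborel (X s)) ?I
          * prod (\<lambda>s. emeasure lborel (X s)) ?J * prod (\<lambda>s. emeasure lborel (X s)) ?K"
        unfolding sym_pairs_Plus by (simp add: prod.union_disjoint)
      moreover have "inj_on ((`) Inl :: 'a set \<Rightarrow> ('a + 'b) set) sym_pairs"
        "inj_on ((`) Inr :: 'b set \<Rightarrow> ('a + 'b) set) sym_pairs" "inj (\<lambda>(j :: 'b, i :: 'a). {Inl i, Inr j})"
        by (auto simp: inj_on_def inj_image_eq_iff doubleton_eq_iff)
      ultimately show ?thesis
        by (simp add: prod.reindex case_prod_unfold o_def)
    qed
    finally show "emeasure (distr ((?Pa \<Otimes>\<^sub>M ?Pb) \<Otimes>\<^sub>M ?N) ?P merge_pairs) (Pi\<^sub>E sym_pairs X)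
        = (\<Prod>s\<in>sym_pairs. emeasure lborel (X s))" .
  qed auto
  then show ?thesis ..
qed

section \<open>Assembling a symmetric matrix from its blocks\<close>

lemma borel_measurable_block [measurable (raw)]:
  fixes f :: "'x \<Rightarrow> real^'a::finite^'a" and k :: "'x \<Rightarrow> real^'b::finite^'b"
  assumes [measurable]: "f \<in> borel_measurable M" "g \<in> borel_measurable M" "h \<in> borel_measurable M" "k \<in> borel_measurable M"
  shows "(\<lambda>x. block_matrix (f x) (g x) (h x) (k x)) \<in> borel_measurable M"
  unfolding block_matrix_def
proof (intro borel_measurable_vec_lambda)
  fix i j :: "'a + 'b"
  show "(\<lambda>x. case i of
          Inl i' \<Rightarrow> (case j of Inl j' \<Rightarrow> f x $ i' $ j' | Inr j' \<Rightarrow> g x $ i' $ j')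
        | Inr i' \<Rightarrow> (case j of Inl j' \<Rightarrow> h x $ i' $ j' | Inr j' \<Rightarrow> k x $ i' $ j')) \<in> borel_measurable M"
    by (cases i; cases j) simp_all
qed

lemma borel_measurable_blocks [measurable]:
  "block11 \<in> borel_measurable borel" "block12 \<in> borel_measurable borel" "block22 \<in> borel_measurable borel"
  unfolding block11_def[abs_def] block12_def[abs_def] block22_def[abs_def]
  by (intro borel_measurable_vec_lambda; measurable)+

definition sym_block :: "((real^'a^'a) \<times> (real^'b^'b)) \<times> (real^'a^'b) \<Rightarrow> real^('a::finite + 'b::finite)^('a + 'b)" where
  "sym_block = (\<lambda>((A, D), T). block_matrix A (transpose T) T D)"

lemma borel_measurable_sym_block [measurable]:
  "sym_block \<in> borel_measurable ((lborel_sym \<Otimes>\<^sub>M lborel_sym) \<Otimes>\<^sub>M lborel)"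
  unfolding sym_block_def case_prod_unfold by measurable

text \<open>Each mixed entry occurs once among the unordered pairs, so the measure splits into the
  three block measures with no constant. The third coordinate is A12^T, the matrix whose law is
  sought.\<close>

lemma lborel_sym_Plus:
  "lborel_sym = distr ((lborel_sym \<Otimes>\<^sub>M lborel_sym) \<Otimes>\<^sub>M lborel) borel
    (sym_block :: ((real^'a^'a) \<times> (real^'b^'b)) \<times> (real^'a^'b) \<Rightarrow> real^('a::finite + 'b::finite)^('a + 'b))"
proof -
  let ?Pa = "Pi\<^sub>M (sym_pairs :: 'a set set) (\<lambda>_. lborel :: real measure)"
    and ?Pb = "Pi\<^sub>M (sym_pairs :: 'b set set) (\<lambda>_. lborel :: real measure)"
    and ?N = "Pi\<^sub>M (UNIV :: ('b \<times> 'a) set) (\<lambda>_. lborel :: real measure)"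
    and ?P = "Pi\<^sub>M (sym_pairs :: ('a + 'b) set set) (\<lambda>_. lborel :: real measure)"
  let ?\<psi> = "\<lambda>h. (\<chi> j i. h (j, i)) :: real^'a^'b"
  have psi[measurable]: "?\<psi> \<in> borel_measurable ?N"
    by (intro borel_measurable_vec_lambda) measurable
  \<comment> \<open>Forming the product of two pushforwards needs sigma-finiteness of the second
    one.\<close>
  have sf: "sigma_finite_measure (distr ?Pb borel sym_matrix)"
    by (simp add: sigma_finite_lborel_sym flip: lborel_sym_eq)
  have "(lborel_sym \<Otimes>\<^sub>M lborel_sym) \<Otimes>\<^sub>M lborel
      = distr (?Pa \<Otimes>\<^sub>M ?Pb) (borel \<Otimes>\<^sub>M borel) (\<lambda>(f, g). (sym_matrix f, sym_matrix g)) \<Otimes>\<^sub>M distr ?N borel ?\<psi>"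
    by (simp add: lborel_sym_eq lborel_matrix_eq_distr_PiM pair_measure_distr[OF _ _ sf])
  also have "\<dots> = distr ((?Pa \<Otimes>\<^sub>M ?Pb) \<Otimes>\<^sub>M ?N) ((borel \<Otimes>\<^sub>M borel) \<Otimes>\<^sub>M borel)
      (\<lambda>(x, h). ((\<lambda>(f, g). (sym_matrix f, sym_matrix g)) x, ?\<psi> h))"
    by (intro pair_measure_distr psi)
      (simp_all add: sigma_finite_lborel flip: lborel_matrix_eq_distr_PiM)
  finally have L: "(lborel_sym \<Otimes>\<^sub>M lborel_sym) \<Otimes>\<^sub>M lborel = \<dots>" .
  have [measurable]: "sym_block \<in> borel_measurable ((borel \<Otimes>\<^sub>M borel) \<Otimes>\<^sub>M (borel :: (real^'a^'b) measure))"
    unfolding sym_block_def case_prod_unfold by measurable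
  have "distr ((lborel_sym \<Otimes>\<^sub>M lborel_sym) \<Otimes>\<^sub>M lborel) borel sym_block
      = distr ((?Pa \<Otimes>\<^sub>M ?Pb) \<Otimes>\<^sub>M ?N) borel (\<lambda>x. sym_matrix (merge_pairs x) :: real^('a + 'b)^('a + 'b))"
    unfolding L
    by (subst distr_distr) (auto simp: o_def case_prod_unfold sym_block_def intro!: distr_cong
        sym_matrix_merge_pairs[symmetric])
  also have "\<dots> = distr ?P borel sym_matrix"
    by (subst PiM_sym_pairs_Plus, subst distr_distr) (auto simp: o_def)
  finally show ?thesis by (simp add: lborel_sym_eq)
qed

section \<open>Conditional distributions from joint densities\<close>

text \<open>The set where the marginal \<open>m\<close> vanishes is null for the law of
  \<open>Y\<close>, so \<open>\<kappa>\<close> is constrained only off it. Finiteness of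
  \<open>m\<close> is what makes the quotient f / m integrate to one there.\<close>

lemma has_conditional_distribution_of_joint_density:
  fixes f :: "'y \<times> 'x \<Rightarrow> ennreal"
  assumes P: "prob_space P" and ST: "sigma_finite_measure S" "sigma_finite_measure T"
    and joint: "distributed P (S \<Otimes>\<^sub>M T) (\<lambda>\<omega>. (Y \<omega>, X \<omega>)) f"
    and sets: "sets K = sets S" "sets N = sets T"
    and fin: "\<And>y. y \<in> space S \<Longrightarrow> (\<integral>\<^sup>+x. f (y, x) \<partial>T) < \<infinity>"
    and \<kappa>: "\<And>y. y \<in> space S \<Longrightarrow> (\<integral>\<^sup>+x. f (y, x) \<partial>T) \<noteq> 0 \<Longrightarrow>
      \<kappa> y = density T (\<lambda>x. f (y, x) / (\<integral>\<^sup>+x. f (y, x) \<partial>T))"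
    and z: "z \<in> space T"
  shows "has_conditional_distribution P N K X Y \<kappa>"
proof -
  interpret prob_space P by fact
  interpret S: sigma_finite_measure S by fact
  interpret T: sigma_finite_measure T by fact
  note joint[measurable]
  have f[measurable]: "f \<in> borel_measurable (S \<Otimes>\<^sub>M T)" by (rule distributed_borel_measurable[OF joint])
  define m where "m y = (\<integral>\<^sup>+x. f (y, x) \<partial>T)" for y
  have [measurable]: "m \<in> borel_measurable S" unfolding m_def[abs_def] by measurable
  have spaces: "space K = space S" "space N = space T"
    using sets by (auto dest: sets_eq_imp_space_eq)
  have YS[measurable]: "Y \<in> P \<rightarrow>\<^sub>M S" and XT[measurable]: "X \<in> P \<rightarrow>\<^sub>M T"
    using measurable_fst'[OF distributed_measurable[OF joint]] measurable_snd'[OF distributed_measurable[OF joint]]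
    by simp_all
  have dY: "distributed P S Y m"
    unfolding m_def[abs_def] by (rule distr_marginal1[OF ST joint])
  have "distr P K Y = distr P S Y" by (rule distr_cong) (use sets in auto)
  then have dK: "distr P K Y = density S m"
    using distributed_distr_eq_density[OF dY] by simp
  \<comment> \<open>A kernel must be a probability measure at every point, also where
    \<open>m\<close> is zero; the point mass at \<open>z\<close> is an arbitrary measurable filler
    for these null points.\<close>
  define \<kappa>' where "\<kappa>' y = (if m y = 0 then return N z else density T (\<lambda>x. f (y, x) / m y))" for y
  have f_y[measurable]: "(\<lambda>x. f (y, x)) \<in> borel_measurable T" if "y \<in> space S" for y
    using that by measurable
  have em: "emeasure (\<kappa>' y) C = (if m y = 0 then indicator C z else (\<integral>\<^sup>+x. f (y, x) / m y * indicator C x \<partial>T))"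
    if "y \<in> space S" "C \<in> sets T" for y C
    using that sets f_y[OF that(1)] by (simp add: \<kappa>'_def emeasure_density)
  have prob: "prob_space (\<kappa>' y)" if y: "y \<in> space S" for y
  proof (cases "m y = 0")
    case True
    then show ?thesis using z spaces by (simp add: \<kappa>'_def prob_space_return)
  next
    case False
    have "(\<integral>\<^sup>+x. f (y, x) / m y \<partial>T) = m y / m y"
      unfolding m_def by (rule nn_integral_divide) (rule f_y[OF y])
    also have "\<dots> = 1"
      using False fin[OF y] by (simp add: m_def ennreal_divide_self)
    finally show ?thesis
      using False f_y[OF y] by (intro prob_spaceI) (simp add: \<kappa>'_def emeasure_density cong: nn_integral_cong)
  qed
  have em_measurable: "(\<lambda>y. emeasure (\<kappa>' y) C) \<in> borel_measurable S" if [measurable]: "C \<in> sets T" for C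
  proof -
    have "(\<lambda>y. if m y = 0 then indicator C z else (\<integral>\<^sup>+x. f (y, x) / m y * indicator C x \<partial>T)) \<in> borel_measurable S"
      by measurable
    then show ?thesis
      by (subst measurable_cong[OF em]) (auto simp: that)
  qed
  have kernel: "\<kappa>' \<in> K \<rightarrow>\<^sub>M prob_algebra N"
  proof (intro measurable_prob_algebraI measurable_subprob_algebra)
    fix C assume "C \<in> sets N"
    then have "(\<lambda>y. emeasure (\<kappa>' y) C) \<in> borel_measurable S"
      by (intro em_measurable) (simp add: sets)
    then show "(\<lambda>y. emeasure (\<kappa>' y) C) \<in> borel_measurable K"
      using measurable_cong_sets[OF sets(1) refl] by blast
  next
    fix y assume "y \<in> space K"
    then show "prob_space (\<kappa>' y)" "subprob_space (\<kappa>' y)"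
      using prob[of y] by (auto simp: spaces prob_space_imp_subprob_space)
    show "sets (\<kappa>' y) = sets N" using sets by (simp add: \<kappa>'_def)
  qed
  moreover have "AE y in distr P K Y. \<kappa>' y = \<kappa> y"
    unfolding dK by (subst AE_density) (auto simp: \<kappa>'_def \<kappa> m_def[symmetric] intro!: AE_I2)
  moreover have "emeasure P {\<omega> \<in> space P. Y \<omega> \<in> B \<and> X \<omega> \<in> C} = (\<integral>\<^sup>+ y \<in> B. emeasure (\<kappa>' y) C \<partial>distr P K Y)"
    if B: "B \<in> sets K" and C: "C \<in> sets N" for B C
  proof -
    have [measurable]: "B \<in> sets S" "C \<in> sets T" using B C sets by auto
    have [measurable]: "(\<lambda>y. emeasure (\<kappa>' y) C) \<in> borel_measurable S"
      by (rule em_measurable) simp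
    have "{\<omega> \<in> space P. Y \<omega> \<in> B \<and> X \<omega> \<in> C} = (\<lambda>\<omega>. (Y \<omega>, X \<omega>)) -` (B \<times> C) \<inter> space P" by auto
    then have "emeasure P {\<omega> \<in> space P. Y \<omega> \<in> B \<and> X \<omega> \<in> C} = (\<integral>\<^sup>+z. f z * indicator (B \<times> C) z \<partial>(S \<Otimes>\<^sub>M T))"
      by (simp add: distributed_emeasure[OF joint])
    also have "\<dots> = (\<integral>\<^sup>+y. \<integral>\<^sup>+x. f (y, x) * indicator (B \<times> C) (y, x) \<partial>T \<partial>S)"
      by (rule T.nn_integral_fst[symmetric]) measurable
    also have "\<dots> = (\<integral>\<^sup>+y. m y * (emeasure (\<kappa>' y) C * indicator B y) \<partial>S)"
    proof (rule nn_integral_cong)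
      fix y assume y: "y \<in> space S"
      note [measurable] = f_y[OF y]
      have "(\<integral>\<^sup>+x. f (y, x) * indicator (B \<times> C) (y, x) \<partial>T) = (\<integral>\<^sup>+x. f (y, x) * indicator C x * indicator B y \<partial>T)"
        by (intro nn_integral_cong) (simp add: indicator_def)
      also have "\<dots> = (\<integral>\<^sup>+x. f (y, x) * indicator C x \<partial>T) * indicator B y"
        by (rule nn_integral_multc) measurable
      also have "(\<integral>\<^sup>+x. f (y, x) * indicator C x \<partial>T) = m y * emeasure (\<kappa>' y) C"
      proof (cases "m y = 0")
        case True
        \<comment> \<open>A vanishing marginal forces the integral over \<open>C\<close> to vanish,
          so the filler value is multiplied by zero.\<close>
        have "(\<integral>\<^sup>+x. f (y, x) * indicator C x \<partial>T) \<le> m y"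
          unfolding m_def by (intro nn_integral_mono) (auto simp: indicator_def)
        then show ?thesis using True by simp
      next
        case False
        have "m y * emeasure (\<kappa>' y) C = (\<integral>\<^sup>+x. m y * (f (y, x) / m y * indicator C x) \<partial>T)"
          using False by (simp add: em[OF y \<open>C \<in> sets T\<close>] nn_integral_cmult)
        also have "m y * (z / m y) = z" for z
          using False fin[OF y] by (simp add: m_def[symmetric] ennreal_times_divide mult.commute[of "m y"] ennreal_mult_divide_eq)
        then have "(\<integral>\<^sup>+x. m y * (f (y, x) / m y * indicator C x) \<partial>T) = (\<integral>\<^sup>+x. f (y, x) * indicator C x \<partial>T)"
          by (simp add: mult.assoc[symmetric])
        finally show ?thesis ..
      qed
      finally show "(\<integral>\<^sup>+x. f (y, x) * indicator (B \<times> C) (y, x) \<partial>T) = m y * (emeasure (\<kappa>' y) C * indicator B y)"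
        by (simp add: mult.assoc)
    qed
    also have "\<dots> = (\<integral>\<^sup>+ y \<in> B. emeasure (\<kappa>' y) C \<partial>distr P K Y)"
      unfolding dK by (rule nn_integral_density[symmetric]) measurable
    finally show ?thesis .
  qed
  moreover have "X \<in> P \<rightarrow>\<^sub>M N" "Y \<in> P \<rightarrow>\<^sub>M K"
    using XT YS measurable_cong_sets[OF refl sets(1)] measurable_cong_sets[OF refl sets(2)] by blast+
  ultimately show ?thesis
    unfolding has_conditional_distribution_def by blast
qed

lemma block11_sym_block [simp]: "block11 (sym_block ((A, D), T)) = A"
  by (simp add: block11_def sym_block_def vec_eq_iff)

lemma block22_sym_block [simp]: "block22 (sym_block ((A, D), T)) = D"
  by (simp add: block22_def sym_block_def vec_eq_iff)

lemma block12_sym_block [simp]: "block12 (sym_block ((A, D), T)) = transpose T"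
  by (simp add: block12_def sym_block_def vec_eq_iff)

text \<open>By \<open>lborel_sym_Plus\<close> the law of \<open>A\<close> is the image under
  \<open>sym_block\<close> of the claimed density on triples of blocks, and extracting the blocks
  undoes \<open>sym_block\<close>.\<close>

lemma distributed_blocks:
  fixes A :: "'w \<Rightarrow> real^('a::finite + 'b::finite)^('a + 'b)"
  assumes "distributed P lborel_sym A p"
  shows "distributed P ((lborel_sym \<Otimes>\<^sub>M lborel_sym) \<Otimes>\<^sub>M lborel)
    (\<lambda>\<omega>. ((block11 (A \<omega>), block22 (A \<omega>)), transpose (block12 (A \<omega>)))) (\<lambda>x. p (sym_block x))"
proof -
  let ?L = "(lborel_sym \<Otimes>\<^sub>M lborel_sym) \<Otimes>\<^sub>M lborel :: (((real^'a^'a) \<times> (real^'b^'b)) \<times> (real^'a^'b)) measure"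
  let ?u = "\<lambda>X :: real^('a + 'b)^('a + 'b). ((block11 X, block22 X), transpose (block12 X))"
  have A[measurable]: "A \<in> P \<rightarrow>\<^sub>M lborel_sym" and p: "p \<in> borel_measurable lborel_sym"
    and dA: "distr P lborel_sym A = density lborel_sym p"
    using assms by (auto simp: distributed_def)
  have p'[measurable]: "p \<in> borel_measurable borel"
    using p by (simp cong: measurable_cong_sets)
  have u[measurable]: "?u \<in> borel \<rightarrow>\<^sub>M ?L" by measurable
  have "distr P ?L (\<lambda>\<omega>. ?u (A \<omega>)) = distr (distr P lborel_sym A) ?L ?u"
    by (subst distr_distr) (auto simp: o_def)
  also have "\<dots> = distr (distr (density ?L (\<lambda>x. p (sym_block x))) borel sym_block) ?L ?u"
    unfolding dA by (subst lborel_sym_Plus, subst density_distr) auto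
  also have "\<dots> = distr (density ?L (\<lambda>x. p (sym_block x))) ?L (\<lambda>x. x)"
    by (subst distr_distr) (auto simp: o_def transpose_transpose intro!: distr_cong)
  also have "\<dots> = density ?L (\<lambda>x. p (sym_block x))"
    by (simp add: distr_id2)
  finally have "distr P ?L (\<lambda>\<omega>. ?u (A \<omega>)) = density ?L (\<lambda>x. p (sym_block x))" .
  moreover have "(\<lambda>\<omega>. ?u (A \<omega>)) \<in> P \<rightarrow>\<^sub>M ?L"
    by (rule measurable_compose[OF A]) (use u in \<open>simp cong: measurable_cong_sets\<close>)
  ultimately show ?thesis
    unfolding distributed_def by auto
qed

text \<open>The first conjunct certifies that the denominator of \<open>conditional_density\<close>,
  introduced as an integral, is the density of the actual law of the diagonal blocks; the second
  ties the resulting ratio to a disintegration of the joint law.\<close>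

theorem mainTheorem1:
  fixes P :: "'w measure"
    and A :: "'w \<Rightarrow> real^('a::finite + 'b::finite)^('a + 'b)"
    and n :: real
    and S :: "real^('a + 'b)^('a + 'b)"
    and S11 :: "real^'a^'a" and S22 :: "real^'b^'b"
  assumes "prob_space P"
    and "n \<ge> real (CARD('a) + CARD('b))"
    and "pos_def S"
    and "S = block_matrix S11 0 0 S22"
    and "distributed P lborel_sym A (\<lambda>X. ennreal (wishart_density n S X))"
  shows
    "distributed P (lborel_sym \<Otimes>\<^sub>M lborel_sym) (\<lambda>\<omega>. (block11 (A \<omega>), block22 (A \<omega>)))
       (\<lambda>(A11, A22). ennreal (diag_blocks_density (wishart_density n S) A11 A22))
     \<and> has_conditional_distribution P borel (borel \<Otimes>\<^sub>M borel)
         (\<lambda>\<omega>. transpose (block12 (A \<omega>))) (\<lambda>\<omega>. (block11 (A \<omega>), block22 (A \<omega>)))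
         (\<lambda>(A11, A22). inv_matrix_t (n - real (CARD('a) + CARD('b)) + 1) 0 A22 A11)
     \<and> (\<forall>A11 A22 A12. pos_def A11 \<and> pos_def A22 \<longrightarrow>
          conditional_density (wishart_density n S) A12 A11 A22
            = inv_matrix_t_density (n - real (CARD('a) + CARD('b)) + 1) 0 A22 A11 (transpose A12))
     \<and> (\<forall>A11 A22 A12. pos_def (block_matrix A11 A12 (transpose A12) A22) \<longrightarrow>
          conditional_density (wishart_density n S) A12 A11 A22
            = (mv_gamma CARD('b) (n / 2) / mv_gamma CARD('b) ((n - real CARD('a)) / 2)
               * (1 / (pi powr (real CARD('a) * real CARD('b) / 2)
                       * det A11 powr ((n - real CARD('a) - 1) / 2)
                       * det A22 powr ((n - real CARD('b) - 1) / 2))))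
              * (det A11 * det A22
                 * det (mat 1 - matrix_inv A22 ** transpose A12 ** matrix_inv A11 ** A12))
                  powr ((n - real (CARD('a) + CARD('b)) - 1) / 2))"
proof (intro conjI allI impI)
  let ?p = "wishart_density n S" and ?q = "diag_blocks_density (wishart_density n S)"
  let ?f = "\<lambda>x. ennreal (?p (sym_block x))"
  note n = assms(2) and S = assms(4,3)
  have joint: "distributed P ((lborel_sym \<Otimes>\<^sub>M lborel_sym) \<Otimes>\<^sub>M lborel)
      (\<lambda>\<omega>. ((block11 (A \<omega>), block22 (A \<omega>)), transpose (block12 (A \<omega>)))) ?f"
    by (rule distributed_blocks[OF assms(5)])
  have sf: "sigma_finite_measure (lborel_sym \<Otimes>\<^sub>M lborel_sym :: ((real^'a^'a) \<times> (real^'b^'b)) measure)"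
    by (intro sigma_finite_pair_measure sigma_finite_lborel_sym)
  have [measurable]: "(\<lambda>X. ennreal (?p X)) \<in> borel_measurable borel"
    using distributed_borel_measurable[OF assms(5)] by (simp cong: measurable_cong_sets)
  \<comment> \<open>The joint density integrates over A12^T, whereas
    \<open>diag_blocks_density\<close> integrates over A12; transposition preserves Lebesgue
    measure.\<close>
  have marginal: "(\<integral>\<^sup>+T. ?f ((A11, A22), T) \<partial>lborel) = ennreal (?q A11 A22)" for A11 A22
  proof -
    have "(\<integral>\<^sup>+T. ?f ((A11, A22), T) \<partial>lborel)
        = (\<integral>\<^sup>+T. ennreal (?p (block_matrix A11 (transpose T) (transpose (transpose T)) A22)) \<partial>lborel)"
      by (simp add: sym_block_def transpose_transpose)
    also have "\<dots> = (\<integral>\<^sup>+Y. ennreal (?p (block_matrix A11 Y (transpose Y) A22)) \<partial>lborel)"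
      by (rule nn_integral_transpose) measurable
    also have "\<dots> = ennreal (?q A11 A22)"
      by (rule wishart_diag_blocks_density(1)[OF S n])
    finally show ?thesis .
  qed
  show "distributed P (lborel_sym \<Otimes>\<^sub>M lborel_sym) (\<lambda>\<omega>. (block11 (A \<omega>), block22 (A \<omega>)))
      (\<lambda>(A11, A22). ennreal (?q A11 A22))"
    using prob_space.distr_marginal1[OF assms(1) sf sigma_finite_lborel joint] by (simp add: marginal case_prod_unfold flip: marginal)
  show "has_conditional_distribution P borel (borel \<Otimes>\<^sub>M borel)
      (\<lambda>\<omega>. transpose (block12 (A \<omega>))) (\<lambda>\<omega>. (block11 (A \<omega>), block22 (A \<omega>)))
      (\<lambda>(A11, A22). inv_matrix_t (n - real (CARD('a) + CARD('b)) + 1) 0 A22 A11)"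
  proof (rule has_conditional_distribution_of_joint_density[OF assms(1) sf sigma_finite_lborel joint, where z = 0])
    show "sets (borel \<Otimes>\<^sub>M borel) = sets (lborel_sym \<Otimes>\<^sub>M lborel_sym :: ((real^'a^'a) \<times> (real^'b^'b)) measure)"
      by (intro sets_pair_measure_cong) simp_all
    fix y :: "(real^'a^'a) \<times> (real^'b^'b)"
    obtain A11 A22 where y: "y = (A11, A22)" by (cases y)
    show "(\<integral>\<^sup>+T. ?f (y, T) \<partial>lborel) < \<infinity>" by (simp add: y marginal)
    assume "(\<integral>\<^sup>+T. ?f (y, T) \<partial>lborel) \<noteq> 0"
    then have "?q A11 A22 \<noteq> 0" by (auto simp: y marginal)
    \<comment> \<open>A nonzero marginal forces both blocks to be positive definite, so the inverted
      t formula is invoked only where it is available.\<close>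
    then have pd: "pos_def A11" "pos_def A22"
      using wishart_diag_blocks_density(3)[OF S n, of A11 A22] by blast+
    note q = wishart_diag_blocks_density(2)[OF S n pd]
    have "ennreal (inv_matrix_t_density (n - real (CARD('a) + CARD('b)) + 1) 0 A22 A11 T)
        = ?f (y, T) / (\<integral>\<^sup>+T. ?f (y, T) \<partial>lborel)" for T
    proof -
      have "?p (sym_block (y, T)) \<ge> 0"
        by (rule wishart_density_nonneg[OF S(2)]) (use n in simp)
      moreover have "inv_matrix_t_density (n - real (CARD('a) + CARD('b)) + 1) 0 A22 A11 T
          = ?p (sym_block (y, T)) / ?q A11 A22"
        using wishart_conditional_density(1)[OF S n pd, of "transpose T"]
        by (simp add: transpose_transpose conditional_density_def y sym_block_def)
      ultimately show ?thesis
        using q by (simp add: y marginal divide_ennreal)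
    qed
    then show "(case y of (A11, A22) \<Rightarrow> inv_matrix_t (n - real (CARD('a) + CARD('b)) + 1) 0 A22 A11)
        = density lborel (\<lambda>T. ?f (y, T) / (\<integral>\<^sup>+T. ?f (y, T) \<partial>lborel))"
      by (simp add: y inv_matrix_t_def)
  qed simp_all
next
  fix A11 :: "real^'a^'a" and A22 :: "real^'b^'b" and A12 :: "real^'b^'a"
  assume "pos_def A11 \<and> pos_def A22"
  then show "conditional_density (wishart_density n S) A12 A11 A22
      = inv_matrix_t_density (n - real (CARD('a) + CARD('b)) + 1) 0 A22 A11 (transpose A12)"
    by (intro wishart_conditional_density(1)[OF assms(4,3,2)]) auto
next
  fix A11 :: "real^'a^'a" and A22 :: "real^'b^'b" and A12 :: "real^'b^'a"
  assume pd: "pos_def (block_matrix A11 A12 (transpose A12) A22)"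
  show "conditional_density (wishart_density n S) A12 A11 A22
      = (mv_gamma CARD('b) (n / 2) / mv_gamma CARD('b) ((n - real CARD('a)) / 2)
         * (1 / (pi powr (real CARD('a) * real CARD('b) / 2)
                 * det A11 powr ((n - real CARD('a) - 1) / 2)
                 * det A22 powr ((n - real CARD('b) - 1) / 2))))
        * (det A11 * det A22
           * det (mat 1 - matrix_inv A22 ** transpose A12 ** matrix_inv A11 ** A12))
            powr ((n - real (CARD('a) + CARD('b)) - 1) / 2)"
    by (rule wishart_conditional_density(2)[OF assms(4,3,2) pos_def_block_imp_diagonal[OF pd] pd])
qed

end
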